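(* Let $G$ be a finitely generated group, and suppose that there exists some finite generating set $S\subseteq G$ (not containing the identity) such that, writing $X=\mathrm{Cay}(G,S)$, the group $$\mathcal{C}_1^{X}(G)=\mathrm{Comm}_{\mathrm{Aut}(X)}(G)\cap\mathrm{Aut}_1(X)$$ is not locally finite. Then there exists a sequence $G\trianglerighteq N_1\trianglerighteq N_2\trianglerighteq\dots$ of normal subgroups of $G$ such that each $G/N_i$ is an infinite bireversible group and $\bigcap_{i=1}^{\infty}N_i=D_G$, where $D_G$ denotes the largest subgroup of $G$ that is normalised by $\mathrm{Comm}_{\mathrm{Aut}(X)}(G)$. In other words, $G/D_G$ is residually infinite bireversible.
   Context: Cayley graphs. For a group $G$ with finite generating set $S$, the (unlabelled) Cayley graph $\mathrm{Cay}(G,S)$ is the directed graph with vertex set $G$ and edge set $\{(g,gs)\mid g\in G, s\in S\cup S^{-1}\}$. $\mathrm{Aut}(X)$ is the group of automorphisms of $X$ as an unlabelled graph, $\mathrm{Aut}_1(X)$ is the stabiliser of the vertex $1\in G$, and $G$ is regarded as a subgroup of $\mathrm{Aut}(X)$ through left multiplication. Commensurator. For $H\leq K$, $\mathrm{Comm}_K(H)=\{k\in K\mid [H:H\cap kHk^{-1}]<\infty,\ [kHk^{-1}:H\cap kHk^{-1}]<\infty\}$. A group is locally finite if all its finitely generated subgroups are finite. $G/D_G$ being residually infinite bireversible means: for every $g\in G\setminus D_G$ there is $D_G\leq N\trianglelefteq G$ such that $g\notin N$ and $G/N$ is an infinite bireversible group. Bireversible groups. A Mealy automaton is a tuple $\mathcal{M}=(A,Q,\lambda,\rho)$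 where $A$ (alphabet) and $Q$ (state set) are finite sets and $\lambda\colon Q\times A\to A$, $\rho\colon Q\times A\to Q$ are maps. It is invertible if $\lambda_q\colon A\to A$, $a\mapsto\lambda(q,a)$ is a bijection for every $q\in Q$; reversible if $\rho_a\colon Q\to Q$, $q\mapsto \rho(q,a)$ is a bijection for every $a\in A$; bireversible if it is invertible, reversible and $Q\times A\to A\times Q$, $(q,a)\mapsto(\lambda(q,a),\rho(q,a))$ is a bijection. Let $A^*$ be the free monoid on $A$. Each $\lambda_q$ extends to $A^*$ by $\lambda_q(aw)=\lambda_q(a)\lambda_{\rho(q,a)}(w)$. If $\mathcal{M}$ is invertible, these are bijections of $A^*$, giving a homomorphism $f_Q$ from the free group $F_Q$ to the group of bijections of $A^*$ (acting on the left), and the group generated by $\mathcal{M}$ is $G_{\mathcal{M}}=F_Q/\ker(f_Q)$. A group is called bireversible if it is isomorphic to $G_{\mathcal{M}}$ for some bireversible automaton $\mathcal{M}$. *)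

theory Defs
  imports "HOL-Algebra.Bij" "HOL-Algebra.Group_Action" "HOL-Algebra.Generated_Groups"
    "Graph_Theory.Pair_Digraph"
begin

section \<open>Cayley graphs, commensurators and the subgroup \<open>D\<^sub>G\<close>\<close>

definition cayley_graph :: "('a, 'm) monoid_scheme \<Rightarrow> 'a set \<Rightarrow> 'a pair_pre_digraph" where
  "cayley_graph G S =
     \<lparr>pverts = carrier G,
      parcs = {(g, g \<otimes>\<^bsub>G\<^esub> s) | g s. g \<in> carrier G \<and> s \<in> S \<union> set_inv\<^bsub>G\<^esub> S}\<rparr>"

text \<open>As in \<^const>\<open>BijGroup\<close>, permutations of the vertex set are extensional functions, so that
  distinct elements of the group are distinct permutations. The product is composition, so the
  group acts on the vertices from the left.\<close>

definition graph_auts :: "'a pair_pre_digraph \<Rightarrow> ('a \<Rightarrow> 'a) set" where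
  "graph_auts X =
     {f \<in> Bij (pverts X). \<forall>u \<in> pverts X. \<forall>v \<in> pverts X. (u, v) \<in> parcs X \<longleftrightarrow> (f u, f v) \<in> parcs X}"

definition Aut_graph :: "'a pair_pre_digraph \<Rightarrow> ('a \<Rightarrow> 'a) monoid" where
  "Aut_graph X = BijGroup (pverts X) \<lparr>carrier := graph_auts X\<rparr>"

definition left_mult :: "('a, 'm) monoid_scheme \<Rightarrow> 'a \<Rightarrow> 'a \<Rightarrow> 'a" where
  "left_mult G g = (\<lambda>x \<in> carrier G. g \<otimes>\<^bsub>G\<^esub> x)"

definition finite_index :: "('a, 'm) monoid_scheme \<Rightarrow> 'a set \<Rightarrow> 'a set \<Rightarrow> bool" where
  "finite_index K H M \<longleftrightarrow> finite (rcosets\<^bsub>K\<lparr>carrier := H\<rparr>\<^esub> M)"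

definition commensurator :: "('a, 'm) monoid_scheme \<Rightarrow> 'a set \<Rightarrow> 'a set" where
  "commensurator K H =
     {k \<in> carrier K.
        let H' = k <#\<^bsub>K\<^esub> H #>\<^bsub>K\<^esub> (inv\<^bsub>K\<^esub> k)
        in finite_index K H (H \<inter> H') \<and> finite_index K H' (H \<inter> H')}"

definition locally_finite :: "('a, 'm) monoid_scheme \<Rightarrow> bool" where
  "locally_finite K \<longleftrightarrow> (\<forall>T \<subseteq> carrier K. finite T \<longrightarrow> finite (generate K T))"

definition comm_Aut :: "('a, 'm) monoid_scheme \<Rightarrow> 'a set \<Rightarrow> ('a \<Rightarrow> 'a) set" where
  "comm_Aut G S = commensurator (Aut_graph (cayley_graph G S)) (left_mult G ` carrier G)"

definition C1_group :: "('a, 'm) monoid_scheme \<Rightarrow> 'a set \<Rightarrow> ('a \<Rightarrow> 'a) monoid" where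
  "C1_group G S =
     (let K = Aut_graph (cayley_graph G S)
      in K \<lparr>carrier := comm_Aut G S \<inter> stabilizer K (\<lambda>f. f) \<one>\<^bsub>G\<^esub>\<rparr>)"

definition normalised_subgroup :: "('a, 'm) monoid_scheme \<Rightarrow> 'a set \<Rightarrow> 'a set \<Rightarrow> bool" where
  "normalised_subgroup G S D \<longleftrightarrow>
     subgroup D G \<and> comm_Aut G S \<subseteq> normalizer (Aut_graph (cayley_graph G S)) (left_mult G ` D)"

text \<open>\<open>GREATEST\<close> is taken with respect to inclusion; lemma \<open>largest_normalised_subgroup\<close> below
  shows that the greatest such subgroup exists.\<close>

definition D_subgroup :: "('a, 'm) monoid_scheme \<Rightarrow> 'a set \<Rightarrow> 'a set" where
  "D_subgroup G S = (GREATEST D. normalised_subgroup G S D)"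


section \<open>Mealy automata and bireversible groups\<close>

record ('a, 'q) mealy =
  alphabet :: "'a set"
  states :: "'q set"
  out_fun :: "'q \<Rightarrow> 'a \<Rightarrow> 'a"
  trans_fun :: "'q \<Rightarrow> 'a \<Rightarrow> 'q"

definition mealy_automaton :: "('a, 'q) mealy \<Rightarrow> bool" where
  "mealy_automaton M \<longleftrightarrow>
     finite (alphabet M) \<and> finite (states M) \<and>
     out_fun M \<in> states M \<rightarrow> alphabet M \<rightarrow> alphabet M \<and>
     trans_fun M \<in> states M \<rightarrow> alphabet M \<rightarrow> states M"

definition mealy_invertible :: "('a, 'q) mealy \<Rightarrow> bool" where
  "mealy_invertible M \<longleftrightarrow> (\<forall>q \<in> states M. bij_betw (out_fun M q) (alphabet M) (alphabet M))"

definition mealy_reversible :: "('a, 'q) mealy \<Rightarrow> bool" where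
  "mealy_reversible M \<longleftrightarrow>
     (\<forall>a \<in> alphabet M. bij_betw (\<lambda>q. trans_fun M q a) (states M) (states M))"

definition mealy_bireversible :: "('a, 'q) mealy \<Rightarrow> bool" where
  "mealy_bireversible M \<longleftrightarrow>
     mealy_automaton M \<and> mealy_invertible M \<and> mealy_reversible M \<and>
     bij_betw (\<lambda>(q, a). (out_fun M q a, trans_fun M q a))
       (states M \<times> alphabet M) (alphabet M \<times> states M)"

primrec extend_output :: "('a, 'q) mealy \<Rightarrow> 'q \<Rightarrow> 'a list \<Rightarrow> 'a list" where
  "extend_output M q [] = []"
| "extend_output M q (a # w) = out_fun M q a # extend_output M (trans_fun M q a) w"

text \<open>The free group on \<open>Q\<close> consists of words in the letters \<open>(q, True)\<close>, standing for \<open>q\<close>, and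
  \<open>(q, False)\<close>, standing for the inverse of \<open>q\<close>, modulo insertion and deletion of adjacent
  mutually inverse letters.\<close>

definition words :: "'q set \<Rightarrow> ('q \<times> bool) list set" where
  "words Q = lists (Q \<times> UNIV)"

definition cancellation :: "'q set \<Rightarrow> ('q \<times> bool) list rel" where
  "cancellation Q =
     {(u @ [(q, b), (q, \<not> b)] @ v, u @ v) | u v q b. u \<in> words Q \<and> v \<in> words Q \<and> q \<in> Q}"

definition free_equiv :: "'q set \<Rightarrow> ('q \<times> bool) list rel" where
  "free_equiv Q = (cancellation Q \<union> (cancellation Q)\<inverse>)\<^sup>* \<inter> words Q \<times> words Q"

definition free_group :: "'q set \<Rightarrow> ('q \<times> bool) list set monoid" where
  "free_group Q =
     \<lparr>carrier = words Q // free_equiv Q,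
      monoid.mult = (\<lambda>X Y. \<Union>u \<in> X. \<Union>v \<in> Y. free_equiv Q `` {u @ v}),
      one = free_equiv Q `` {[]}\<rparr>"

abbreviation word_bijs :: "('a, 'q) mealy \<Rightarrow> ('a list \<Rightarrow> 'a list) monoid" where
  "word_bijs M \<equiv> BijGroup (lists (alphabet M))"

definition state_bij :: "('a, 'q) mealy \<Rightarrow> 'q \<Rightarrow> 'a list \<Rightarrow> 'a list" where
  "state_bij M q = (\<lambda>w \<in> lists (alphabet M). extend_output M q w)"

primrec word_action :: "('a, 'q) mealy \<Rightarrow> ('q \<times> bool) list \<Rightarrow> 'a list \<Rightarrow> 'a list" where
  "word_action M [] = \<one>\<^bsub>word_bijs M\<^esub>"
| "word_action M (x # u) =
     (if snd x then state_bij M (fst x) else inv\<^bsub>word_bijs M\<^esub> (state_bij M (fst x)))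
       \<otimes>\<^bsub>word_bijs M\<^esub> word_action M u"

text \<open>For an invertible automaton \<^const>\<open>word_action\<close> is constant on each class of words, see
  \<open>free_group_hom_class\<close> below.\<close>

definition free_group_hom :: "('a, 'q) mealy \<Rightarrow> ('q \<times> bool) list set \<Rightarrow> 'a list \<Rightarrow> 'a list" where
  "free_group_hom M X = the_elem (word_action M ` X)"

definition mealy_group :: "('a, 'q) mealy \<Rightarrow> ('q \<times> bool) list set set monoid" where
  "mealy_group M =
     free_group (states M) Mod kernel (free_group (states M)) (word_bijs M) (free_group_hom M)"

text \<open>Alphabet and state set are finite, so up to renaming letters and states they may be taken to
  be sets of natural numbers; this avoids quantifying over types.\<close>

definition bireversible_group :: "('g, 'm) monoid_scheme \<Rightarrow> bool" where
  "bireversible_group H \<longleftrightarrow>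
     (\<exists>M :: (nat, nat) mealy. mealy_bireversible M \<and> H \<cong> mealy_group M)"

text \<open>That the quotient of \<open>G\<close> by \<open>D\<close> is residually infinite bireversible, expressed inside \<open>G\<close>.\<close>

definition residually_infinite_bireversible_mod :: "('a, 'm) monoid_scheme \<Rightarrow> 'a set \<Rightarrow> bool" where
  "residually_infinite_bireversible_mod G D \<longleftrightarrow>
     (\<forall>g \<in> carrier G - D. \<exists>N. N \<lhd> G \<and> D \<subseteq> N \<and> g \<notin> N \<and>
        infinite (carrier (G Mod N)) \<and> bireversible_group (G Mod N))"


section \<open>Well-definedness\<close>

subsection \<open>Automorphisms of the Cayley graph\<close>

lemma subgroup_graph_auts: "subgroup (graph_auts X) (BijGroup (pverts X))"
proof (rule group.subgroupI[OF group_BijGroup])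
  show "graph_auts X \<subseteq> carrier (BijGroup (pverts X))"
    by (auto simp: graph_auts_def BijGroup_def)
  have "(\<lambda>x \<in> pverts X. x) \<in> graph_auts X"
    by (auto simp: graph_auts_def id_Bij)
  then show "graph_auts X \<noteq> {}" by blast
next
  fix f assume f: "f \<in> graph_auts X"
  then have fB: "f \<in> Bij (pverts X)" by (simp add: graph_auts_def)
  then have im: "f ` pverts X = pverts X" by (simp add: Bij_def bij_betw_def)
  let ?g = "\<lambda>x \<in> pverts X. inv_into (pverts X) f x"
  have "?g \<in> graph_auts X"
    using f restrict_inv_into_Bij[OF fB] Bij_inv_into_mem[OF fB] im
    by (auto simp: graph_auts_def f_inv_into_f)
  then show "inv\<^bsub>BijGroup (pverts X)\<^esub> f \<in> graph_auts X"
    by (simp add: inv_BijGroup[OF fB])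
next
  fix f g assume fg: "f \<in> graph_auts X" "g \<in> graph_auts X"
  then have B: "f \<in> Bij (pverts X)" "g \<in> Bij (pverts X)" by (simp_all add: graph_auts_def)
  have "(u, v) \<in> parcs X \<longleftrightarrow> (f (g u), f (g v)) \<in> parcs X"
    if "u \<in> pverts X" "v \<in> pverts X" for u v
    using fg that funcset_mem[OF Bij_imp_funcset[OF B(2)]] unfolding graph_auts_def by blast
  then show "f \<otimes>\<^bsub>BijGroup (pverts X)\<^esub> g \<in> graph_auts X"
    using B by (simp add: graph_auts_def BijGroup_def compose_Bij compose_eq)
qed

lemma group_Aut_graph: "group (Aut_graph X)"
  unfolding Aut_graph_def
  by (rule subgroup.subgroup_is_group[OF subgroup_graph_auts group_BijGroup])

lemma left_mult_hom:
  fixes G (structure)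
  assumes "group G" and S: "S \<subseteq> carrier G"
  shows "left_mult G \<in> hom G (Aut_graph (cayley_graph G S))"
    and "inj_on (left_mult G) (carrier G)"
proof -
  interpret group G by fact
  have B: "left_mult G g \<in> Bij (carrier G)" if g: "g \<in> carrier G" for g
  proof -
    have "bij_betw (\<lambda>x. g \<otimes> x) (carrier G) (carrier G)"
      by (rule bij_betw_byWitness[where f' = "\<lambda>x. inv g \<otimes> x"])
        (use g in \<open>auto simp: m_assoc[symmetric]\<close>)
    then show ?thesis
      unfolding Bij_def left_mult_def by (auto cong: bij_betw_cong)
  qed
  have A: "left_mult G g \<in> graph_auts (cayley_graph G S)" if g: "g \<in> carrier G" for g
  proof -
    let ?T = "S \<union> set_inv\<^bsub>G\<^esub> S"
    have T: "?T \<subseteq> carrier G" using S by (auto simp: SET_INV_def)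
    have "(u, v) \<in> parcs (cayley_graph G S) \<longleftrightarrow> (\<exists>s \<in> ?T. v = u \<otimes> s)" if "u \<in> carrier G" for u v
      using that by (auto simp: cayley_graph_def)
    moreover have "g \<otimes> v = g \<otimes> u \<otimes> s \<longleftrightarrow> v = u \<otimes> s"
      if "u \<in> carrier G" "v \<in> carrier G" "s \<in> ?T" for u v s
    proof -
      have "s \<in> carrier G" using T that by blast
      then show ?thesis using that g by (simp add: m_assoc)
    qed
    moreover have "pverts (cayley_graph G S) = carrier G" by (simp add: cayley_graph_def)
    ultimately show ?thesis
      using g B[OF g] by (simp add: graph_auts_def) (simp add: left_mult_def)
  qed
  show "left_mult G \<in> hom G (Aut_graph (cayley_graph G S))"
  proof (rule homI)
    fix g h assume gh: "g \<in> carrier G" "h \<in> carrier G"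
    show "left_mult G g \<in> carrier (Aut_graph (cayley_graph G S))"
      using A gh by (simp add: Aut_graph_def)
    show "left_mult G (g \<otimes> h) = left_mult G g \<otimes>\<^bsub>Aut_graph (cayley_graph G S)\<^esub> left_mult G h"
      using gh B by (auto simp: Aut_graph_def BijGroup_def cayley_graph_def compose_def
          left_mult_def m_assoc fun_eq_iff restrict_def)
  qed
  show "inj_on (left_mult G) (carrier G)"
  proof (rule inj_onI)
    fix g h assume gh: "g \<in> carrier G" "h \<in> carrier G" "left_mult G g = left_mult G h"
    then have "left_mult G g \<one> = left_mult G h \<one>" by simp
    then show "g = h" using gh by (simp add: left_mult_def)
  qed
qed

subsection \<open>The largest normalised subgroup\<close>

lemma conj_coset_eq:
  "k <#\<^bsub>K\<^esub> H #>\<^bsub>K\<^esub> (inv\<^bsub>K\<^esub> k) = (\<lambda>h. k \<otimes>\<^bsub>K\<^esub> h \<otimes>\<^bsub>K\<^esub> inv\<^bsub>K\<^esub> k) ` H"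
  by (auto simp: l_coset_def r_coset_def)

lemma normalizer_eq:
  assumes "H \<subseteq> carrier K"
  shows "normalizer K H =
    {k \<in> carrier K. (\<lambda>h. k \<otimes>\<^bsub>K\<^esub> h \<otimes>\<^bsub>K\<^esub> inv\<^bsub>K\<^esub> k) ` H = H}"
  using assms by (auto simp: normalizer_def stabilizer_def conj_coset_eq)

lemma (in group) conj_hom:
  assumes "k \<in> carrier G"
  shows "(\<lambda>h. k \<otimes> h \<otimes> inv k) \<in> hom G G"
proof (rule homI)
  fix x y assume "x \<in> carrier G" "y \<in> carrier G"
  then show "k \<otimes> (x \<otimes> y) \<otimes> inv k = k \<otimes> x \<otimes> inv k \<otimes> (k \<otimes> y \<otimes> inv k)"
    using assms by (simp add: m_assoc inv_solve_left)
qed (use assms in simp)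

lemma largest_normalised_subgroup:
  assumes "group G" and S: "S \<subseteq> carrier G"
  shows "normalised_subgroup G S (D_subgroup G S)"
    and "normalised_subgroup G S D \<Longrightarrow> D \<subseteq> D_subgroup G S"
proof -
  interpret group G by fact
  define K where "K = Aut_graph (cayley_graph G S)"
  interpret K: group K unfolding K_def by (rule group_Aut_graph)
  have hom: "left_mult G \<in> hom G K" using left_mult_hom(1)[OF assms] by (simp add: K_def)
  interpret L: group_hom G K "left_mult G"
    by (intro group_hom.intro group_hom_axioms.intro) (fact group_axioms K.group_axioms hom)+
  define P where "P = normalised_subgroup G S"
  define U where "U = \<Union>(Collect P)"
  have sub: "D \<subseteq> carrier G" if "P D" for D
    using that by (auto simp: P_def normalised_subgroup_def dest: subgroup.subset)
  have im: "left_mult G ` D \<subseteq> carrier K" if "D \<subseteq> carrier G" for D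
    using that by auto
  have commK: "comm_Aut G S \<subseteq> carrier K" by (auto simp: comm_Aut_def commensurator_def K_def)
  have U: "U \<subseteq> carrier G" using sub by (auto simp: U_def)
  have P_iff: "P D \<longleftrightarrow> subgroup D G \<and>
      (\<forall>k \<in> comm_Aut G S. (\<lambda>h. k \<otimes>\<^bsub>K\<^esub> h \<otimes>\<^bsub>K\<^esub> inv\<^bsub>K\<^esub> k) ` left_mult G ` D = left_mult G ` D)"
    if "D \<subseteq> carrier G" for D
    unfolding P_def normalised_subgroup_def K_def[symmetric] normalizer_eq[OF im[OF that]]
    using commK by blast
  have gen: "P (generate G U)"
  proof (subst P_iff)
    show "generate G U \<subseteq> carrier G" by (rule generate_incl[OF U])
    show "subgroup (generate G U) G \<and> (\<forall>k \<in> comm_Aut G S.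
        (\<lambda>h. k \<otimes>\<^bsub>K\<^esub> h \<otimes>\<^bsub>K\<^esub> inv\<^bsub>K\<^esub> k) ` left_mult G ` generate G U = left_mult G ` generate G U)"
    proof (intro conjI ballI)
      show "subgroup (generate G U) G" by (rule generate_is_subgroup[OF U])
      fix k assume k: "k \<in> comm_Aut G S"
      then have kK: "k \<in> carrier K" using commK by blast
      let ?c = "\<lambda>h. k \<otimes>\<^bsub>K\<^esub> h \<otimes>\<^bsub>K\<^esub> inv\<^bsub>K\<^esub> k"
      interpret c: group_hom K K ?c
        by (intro group_hom.intro group_hom_axioms.intro)
          (fact K.group_axioms K.conj_hom[OF kK])+
      have "?c ` left_mult G ` generate G U = generate K (?c ` left_mult G ` U)"
        using c.generate_img[OF im[OF U]] L.generate_img[OF U] by simp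
      also have "?c ` left_mult G ` U = (\<Union>D \<in> Collect P. ?c ` left_mult G ` D)"
        by (auto simp: U_def)
      also have "\<dots> = (\<Union>D \<in> Collect P. left_mult G ` D)"
        using P_iff[OF sub] k by (intro SUP_cong) auto
      also have "\<dots> = left_mult G ` U" by (auto simp: U_def)
      also have "generate K (left_mult G ` U) = left_mult G ` generate G U"
        using L.generate_img[OF U] by simp
      finally show "?c ` left_mult G ` generate G U = left_mult G ` generate G U" .
    qed
  qed
  have le: "D \<le> generate G U" if "P D" for D
    using that by (auto simp: U_def intro!: generate.incl)
  have "D_subgroup G S = generate G U"
    unfolding D_subgroup_def P_def[symmetric] by (rule Greatest_equality[of P, OF gen le])
  then show "normalised_subgroup G S (D_subgroup G S)"
    and "normalised_subgroup G S D \<Longrightarrow> D \<subseteq> D_subgroup G S"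
    using gen le by (simp_all add: P_def)
qed


subsection \<open>Free groups\<close>

lemma words_append [simp]: "u @ v \<in> words Q \<longleftrightarrow> u \<in> words Q \<and> v \<in> words Q"
  by (simp add: words_def)

lemma Nil_words [simp]: "[] \<in> words Q"
  by (simp add: words_def)

lemma Cons_words [simp]: "x # u \<in> words Q \<longleftrightarrow> fst x \<in> Q \<and> u \<in> words Q"
  by (cases x) (auto simp: words_def)

lemma equiv_free_equiv: "equiv (words Q) (free_equiv Q)"
proof (rule equivI)
  have "sym ((cancellation Q \<union> (cancellation Q)\<inverse>)\<^sup>*)"
    by (intro sym_rtrancl sym_Un_converse)
  then show "sym (free_equiv Q)"
    unfolding free_equiv_def by (auto simp: sym_def)
  show "trans (free_equiv Q)"
    unfolding free_equiv_def by (auto intro!: transI dest: rtrancl_trans)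
  show "refl_on (words Q) (free_equiv Q)"
    unfolding free_equiv_def by (auto simp: refl_on_def)
  show "free_equiv Q \<subseteq> words Q \<times> words Q"
    unfolding free_equiv_def by blast
qed

lemma free_equiv_context:
  assumes "(u, v) \<in> free_equiv Q" "s \<in> words Q" "t \<in> words Q"
  shows "(s @ u @ t, s @ v @ t) \<in> free_equiv Q"
proof -
  let ?r = "cancellation Q"
  have r: "(s @ x @ t, s @ y @ t) \<in> ?r" if xy: "(x, y) \<in> ?r" for x y
  proof -
    obtain p p' q b where "x = p @ [(q, b), (q, \<not> b)] @ p'" "y = p @ p'"
      "p \<in> words Q" "p' \<in> words Q" "q \<in> Q"
      using xy unfolding cancellation_def by blast
    then show ?thesis
      using assms(2,3) unfolding cancellation_def
      by (intro CollectI exI[of _ "s @ p"] exI[of _ "p' @ t"] exI[of _ q] exI[of _ b]) simp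
  qed
  have "(u, v) \<in> (?r \<union> ?r\<inverse>)\<^sup>*" using assms(1) by (simp add: free_equiv_def)
  then have "(s @ u @ t, s @ v @ t) \<in> (?r \<union> ?r\<inverse>)\<^sup>*"
  proof induction
    case (step y z)
    then have "(s @ y @ t, s @ z @ t) \<in> ?r \<union> ?r\<inverse>" using r by blast
    with step.IH show ?case by (rule rtrancl_into_rtrancl)
  qed simp
  then show ?thesis using assms by (auto simp: free_equiv_def)
qed

lemma free_equiv_append:
  assumes "(u, u') \<in> free_equiv Q" "(v, v') \<in> free_equiv Q"
  shows "(u @ v, u' @ v') \<in> free_equiv Q"
proof -
  have "v \<in> words Q" "u' \<in> words Q" using assms by (auto simp: free_equiv_def)
  then have "(u @ v, u' @ v) \<in> free_equiv Q" "(u' @ v, u' @ v') \<in> free_equiv Q"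
    using free_equiv_context[OF assms(1), of "[]" v] free_equiv_context[OF assms(2), of u' "[]"]
    by simp_all
  then show ?thesis using equiv_free_equiv by (meson equivE transE)
qed

abbreviation free_class :: "'q set \<Rightarrow> ('q \<times> bool) list \<Rightarrow> ('q \<times> bool) list set" where
  "free_class Q u \<equiv> free_equiv Q `` {u}"

lemma free_class_eqI: "(u, v) \<in> free_equiv Q \<Longrightarrow> free_class Q u = free_class Q v"
  by (rule equiv_class_eq[OF equiv_free_equiv])

lemma free_class_self: "u \<in> words Q \<Longrightarrow> u \<in> free_class Q u"
  by (rule equiv_class_self[OF equiv_free_equiv])

lemma free_group_mult:
  assumes "u \<in> words Q" "v \<in> words Q"
  shows "free_class Q u \<otimes>\<^bsub>free_group Q\<^esub> free_class Q v = free_class Q (u @ v)"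
proof -
  have "free_class Q (u' @ v') = free_class Q (u @ v)"
    if "u' \<in> free_class Q u" "v' \<in> free_class Q v" for u' v'
    using free_class_eqI[OF free_equiv_append[of u u' Q v v']] that by simp
  moreover have "u \<in> free_class Q u" "v \<in> free_class Q v"
    using assms free_class_self by blast+
  ultimately show ?thesis unfolding free_group_def monoid.simps by blast
qed

lemma free_group_carrier: "carrier (free_group Q) = free_class Q ` words Q"
  by (auto simp: free_group_def quotient_def)

definition inverse_word :: "('q \<times> bool) list \<Rightarrow> ('q \<times> bool) list" where
  "inverse_word u = map (\<lambda>(q, b). (q, \<not> b)) (rev u)"

lemma inverse_word_words: "u \<in> words Q \<Longrightarrow> inverse_word u \<in> words Q"
  by (auto simp: inverse_word_def words_def)

lemma inverse_word_cancel:
  "u \<in> words Q \<Longrightarrow> (inverse_word u @ u, []) \<in> free_equiv Q"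
proof (induction u)
  case Nil
  then show ?case by (simp add: inverse_word_def free_equiv_def)
next
  case (Cons x u)
  obtain q b where x: "x = (q, b)" by (cases x)
  have w: "u \<in> words Q" "inverse_word u \<in> words Q" "q \<in> Q"
    using Cons.prems inverse_word_words[of u Q] by (auto simp: x)
  have "(inverse_word u @ [(q, \<not> b), (q, \<not> \<not> b)] @ u, inverse_word u @ u) \<in> cancellation Q"
    unfolding cancellation_def using w by blast
  then have "(inverse_word (x # u) @ x # u, inverse_word u @ u) \<in> free_equiv Q"
    using w by (auto simp: free_equiv_def inverse_word_def x)
  then show ?case using Cons w equiv_free_equiv by (metis equivE transE)
qed

theorem group_free_group: "group (free_group Q)"
proof (rule groupI)
  have one: "\<one>\<^bsub>free_group Q\<^esub> = free_class Q []" by (simp add: free_group_def)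
  show "\<one>\<^bsub>free_group Q\<^esub> \<in> carrier (free_group Q)" by (simp add: one free_group_carrier)
  fix x assume "x \<in> carrier (free_group Q)"
  then obtain u where u: "u \<in> words Q" "x = free_class Q u" by (auto simp: free_group_carrier)
  then show "\<one>\<^bsub>free_group Q\<^esub> \<otimes>\<^bsub>free_group Q\<^esub> x = x"
    by (simp add: one free_group_mult)
  show "\<exists>y \<in> carrier (free_group Q). y \<otimes>\<^bsub>free_group Q\<^esub> x = \<one>\<^bsub>free_group Q\<^esub>"
    using u free_class_eqI[OF inverse_word_cancel[OF u(1)]]
    by (intro bexI[of _ "free_class Q (inverse_word u)"])
      (simp_all add: one free_group_mult free_group_carrier inverse_word_words)
  fix y assume "y \<in> carrier (free_group Q)"
  then obtain v where v: "v \<in> words Q" "y = free_class Q v" by (auto simp: free_group_carrier)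
  show "x \<otimes>\<^bsub>free_group Q\<^esub> y \<in> carrier (free_group Q)"
    using u v by (simp add: free_group_mult free_group_carrier)
  fix z assume "z \<in> carrier (free_group Q)"
  then obtain w where w: "w \<in> words Q" "z = free_class Q w" by (auto simp: free_group_carrier)
  show "x \<otimes>\<^bsub>free_group Q\<^esub> y \<otimes>\<^bsub>free_group Q\<^esub> z =
        x \<otimes>\<^bsub>free_group Q\<^esub> (y \<otimes>\<^bsub>free_group Q\<^esub> z)"
    using u v w by (simp add: free_group_mult)
qed

subsection \<open>The homomorphism from the free group\<close>

lemma state_bij_Bij:
  assumes M: "mealy_automaton M" "mealy_invertible M" and q: "q \<in> states M"
  shows "state_bij M q \<in> Bij (lists (alphabet M))"
proof -
  let ?A = "alphabet M"
  have out: "bij_betw (out_fun M p) ?A ?A" if "p \<in> states M" for p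
    using M that by (auto simp: mealy_invertible_def)
  have tr: "trans_fun M p a \<in> states M" if "p \<in> states M" "a \<in> ?A" for p a
    using M that by (auto simp: mealy_automaton_def)
  have in_A: "extend_output M p w \<in> lists ?A" if "w \<in> lists ?A" "p \<in> states M" for p w
    using that by (induction w arbitrary: p) (auto simp: tr bij_betwE[OF out])
  have surj: "\<exists>v \<in> lists ?A. extend_output M p v = w" if "w \<in> lists ?A" "p \<in> states M" for p w
    using that
  proof (induction w arbitrary: p)
    case (Cons a w)
    obtain c where c: "c \<in> ?A" "out_fun M p c = a"
      using bij_betw_imp_surj_on[OF out[OF Cons.prems]] Cons.hyps by (metis imageE)
    obtain v where v: "v \<in> lists ?A" "extend_output M (trans_fun M p c) v = w"
      using Cons.IH[OF tr[OF Cons.prems c(1)]] by blast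
    show ?case using c v by (intro bexI[of _ "c # v"]) auto
  qed (auto intro: bexI[of _ "[]"])
  have inj: "v = w" if "v \<in> lists ?A" "w \<in> lists ?A" "p \<in> states M"
    "extend_output M p v = extend_output M p w" for p v w
    using that
  proof (induction v arbitrary: p w)
    case Nil
    then show ?case by (cases w) auto
  next
    case (Cons a v)
    then obtain c w' where w: "w = c # w'" by (cases w) auto
    have p: "p \<in> states M" using Cons.prems by blast
    have "a = c"
      using Cons.prems Cons.hyps bij_betw_imp_inj_on[OF out[OF p]] w by (auto dest: inj_onD)
    then show ?case using Cons w tr by auto
  qed
  have "bij_betw (extend_output M q) (lists ?A) (lists ?A)"
  proof (rule bij_betw_imageI)
    show "inj_on (extend_output M q) (lists ?A)"
      using inj[OF _ _ q] by (rule inj_onI)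
    show "extend_output M q ` lists ?A = lists ?A"
      using in_A[OF _ q] surj[OF _ q] by (intro equalityI subsetI) (blast, metis imageI)
  qed
  then show ?thesis
    unfolding Bij_def state_bij_def by (auto cong: bij_betw_cong)
qed

context
  fixes M :: "('a, 'q) mealy"
  assumes M: "mealy_automaton M" "mealy_invertible M"
begin

interpretation B: group "word_bijs M" by (rule group_BijGroup)

lemma state_bij_carrier: "q \<in> states M \<Longrightarrow> state_bij M q \<in> carrier (word_bijs M)"
  using state_bij_Bij[OF M] by (simp add: BijGroup_def)

lemma word_action_carrier: "u \<in> words (states M) \<Longrightarrow> word_action M u \<in> carrier (word_bijs M)"
  by (induction u) (auto simp: state_bij_carrier)

lemma word_action_append:
  "u \<in> words (states M) \<Longrightarrow> v \<in> words (states M) \<Longrightarrow>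
   word_action M (u @ v) = word_action M u \<otimes>\<^bsub>word_bijs M\<^esub> word_action M v"
  by (induction u) (auto simp: state_bij_carrier word_action_carrier B.m_assoc)

lemma word_action_free_equiv:
  assumes "(u, v) \<in> free_equiv (states M)"
  shows "word_action M u = word_action M v"
proof -
  let ?r = "cancellation (states M)"
  have r: "word_action M x = word_action M y" if xy: "(x, y) \<in> ?r" for x y
  proof -
    obtain p p' q b where x: "x = p @ [(q, b), (q, \<not> b)] @ p'" "y = p @ p'"
      "p \<in> words (states M)" "p' \<in> words (states M)" "q \<in> states M"
      using xy unfolding cancellation_def by blast
    have "word_action M [(q, b), (q, \<not> b)] = \<one>\<^bsub>word_bijs M\<^esub>"
      using state_bij_carrier[OF x(5)] by simp
    then have "word_action M ([(q, b), (q, \<not> b)] @ p') = word_action M p'"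
      using x by (subst word_action_append) (simp_all add: word_action_carrier)
    then show ?thesis
      using x by (simp add: word_action_append del: word_action.simps append.simps)
  qed
  have "(u, v) \<in> (?r \<union> ?r\<inverse>)\<^sup>*" using assms by (simp add: free_equiv_def)
  then show ?thesis
    by induction (auto dest: r)
qed

lemma free_group_hom_class:
  assumes "u \<in> words (states M)"
  shows "free_group_hom M (free_class (states M) u) = word_action M u"
proof -
  have "word_action M ` free_class (states M) u = {word_action M u}"
    using free_class_self[OF assms] by (auto intro: word_action_free_equiv[symmetric])
  then show ?thesis by (simp add: free_group_hom_def)
qed

theorem free_group_hom_hom: "free_group_hom M \<in> hom (free_group (states M)) (word_bijs M)"
  by (rule homI)
    (auto simp: free_group_carrier free_group_hom_class word_action_carrier free_group_mult
      word_action_append)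

end

end

theory Submission
  imports Defs
begin

text \<open>Let \<open>k\<close> be an automorphism of the Cayley graph that fixes the identity. Seen from a vertex \<open>g\<close>
  it acts as another such automorphism, its local action at \<open>g\<close>, characterised by
  \<open>k (g \<otimes> h) = k g \<otimes> local_action k g h\<close>. The translations by \<open>a\<close> and \<open>b\<close> have the same coset
  modulo the intersection of \<open>G\<close> with its conjugate by the inverse of \<open>k\<close> exactly when the local
  actions of \<open>k\<close> at \<open>a\<close> and \<open>b\<close> agree; so \<open>k\<close> lies in the commensurator if and only if it has only finitely many
  local actions (\<open>comm_Aut_iff\<close>).

  Take a finite set \<open>F\<close> of such automorphisms. Its closure under local actions is finite, and it
  acts on words in the letters \<open>S\<close> and their inverses by a bireversible automaton. The dual
  automaton has the letters as states and the closure of \<open>F\<close> as alphabet, and its action on words of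
  automorphisms extends to an action of \<open>G\<close>, in which an element \<open>g\<close> turns \<open>k\<close> into its local action
  at \<open>g\<close> (up to inversion). Hence the quotient of \<open>G\<close> by the kernel of this action is a bireversible
  group (\<open>dual_kernel_bireversible\<close>). The kernel is the largest subgroup that each \<open>k\<close> in the closure
  maps into itself and along which \<open>k\<close> equals its own local actions; in particular
  \<open>k (n \<otimes> x) = k n \<otimes> k x\<close> for \<open>n\<close> in the kernel.

  If the kernel has finite index, this equivariance determines an automorphism by its restriction to
  a finite ball, so \<open>F\<close> generates a finite group, once \<open>F\<close> is closed under inverses. A set that
  generates an infinite group therefore gives an infinite quotient (\<open>infinite_dual_quotient\<close>). For a
  normal subgroup of \<open>G\<close>, the condition describing the kernel, imposed for all \<open>k\<close> in the commensurator
  that fix the identity, says that the commensurator normalises the subgroup; so the intersection of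
  all the kernels is \<open>D\<^sub>G\<close> (\<open>D_subgroup_eq\<close>). As \<open>G\<close> is a countable union of finite balls, a decreasing sequence of kernels
  suffices for this intersection.\<close>

section \<open>Quotients by self-similar actions are automaton groups\<close>

lemma (in group_hom) FactGroup_iso_image:
  "G Mod kernel G H h \<cong> H\<lparr>carrier := h ` carrier G\<rparr>"
proof -
  interpret I: group "H\<lparr>carrier := h ` carrier G\<rparr>"
    by (rule subgroup.subgroup_is_group[OF img_is_subgroup H.group_axioms])
  interpret h': group_hom G "H\<lparr>carrier := h ` carrier G\<rparr>" h
    by unfold_locales (auto simp: hom_def)
  have "kernel G (H\<lparr>carrier := h ` carrier G\<rparr>) h = kernel G H h"
    by (simp add: kernel_def)
  then show ?thesis using h'.FactGroup_iso by simp
qed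

text \<open>The group of an automaton is a quotient of a free group by construction. By the first
  isomorphism theorem it is the group of permutations of words generated by the states, and this is
  the form in which it can be compared with a quotient of another group.\<close>

lemma mealy_group_iso:
  assumes M: "mealy_automaton M" "mealy_invertible M"
  shows "mealy_group M \<cong>
    (word_bijs M)\<lparr>carrier := generate (word_bijs M) (state_bij M ` states M)\<rparr>"
proof -
  let ?W = "word_bijs M" and ?F = "free_group (states M)"
  interpret W: group ?W by (rule group_BijGroup)
  interpret f: group_hom ?F ?W "free_group_hom M"
    by (intro group_hom.intro group_hom_axioms.intro group_free_group group_BijGroup
        free_group_hom_hom[OF M])
  have img: "free_group_hom M ` carrier ?F = word_action M ` words (states M)"
    by (auto simp: free_group_carrier image_image free_group_hom_class[OF M])
  have "word_action M u \<in> generate ?W (state_bij M ` states M)" if "u \<in> words (states M)" for u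
    using that by (induction u) (auto intro: generate.intros)
  moreover have "state_bij M q \<in> word_action M ` words (states M)" if q: "q \<in> states M" for q
    using q state_bij_carrier[OF M q] by (intro image_eqI[of _ _ "[(q, True)]"]) auto
  then have "generate ?W (state_bij M ` states M) \<subseteq> word_action M ` words (states M)"
    using W.generate_subgroup_incl[OF _ f.img_is_subgroup] by (simp add: img image_subset_iff)
  ultimately have "free_group_hom M ` carrier ?F = generate ?W (state_bij M ` states M)"
    unfolding img by blast
  then show ?thesis
    using f.FactGroup_iso_image by (simp add: mealy_group_def)
qed

text \<open>A group element acts on a word letter by letter: it changes the first letter by \<open>out\<close> and
  passes to the rest of the word as the element given by \<open>tr\<close>. The cocycle identity for \<open>tr\<close> is what
  makes this a left action on words of every length. If \<open>A\<close> is finite and a finite generating set is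
  stable under \<open>tr\<close>, that set is the state set of a Mealy automaton whose action on words is the given one.\<close>

locale self_similar_action = group G for G (structure) +
  fixes A :: "'b set" and out :: "'a \<Rightarrow> 'b \<Rightarrow> 'b" and tr :: "'a \<Rightarrow> 'b \<Rightarrow> 'a"
  assumes out_closed: "\<lbrakk>g \<in> carrier G; a \<in> A\<rbrakk> \<Longrightarrow> out g a \<in> A"
    and tr_closed: "\<lbrakk>g \<in> carrier G; a \<in> A\<rbrakk> \<Longrightarrow> tr g a \<in> carrier G"
    and out_one: "a \<in> A \<Longrightarrow> out \<one> a = a"
    and out_mult: "\<lbrakk>g \<in> carrier G; h \<in> carrier G; a \<in> A\<rbrakk> \<Longrightarrow> out (g \<otimes> h) a = out g (out h a)"
    and tr_mult: "\<lbrakk>g \<in> carrier G; h \<in> carrier G; a \<in> A\<rbrakk> \<Longrightarrow> tr (g \<otimes> h) a = tr g (out h a) \<otimes> tr h a"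
begin

primrec act :: "'a \<Rightarrow> 'b list \<Rightarrow> 'b list" where
  "act g [] = []"
| "act g (a # w) = out g a # act (tr g a) w"

definition act_kernel :: "'a set" where
  "act_kernel = {g \<in> carrier G. \<forall>w \<in> lists A. act g w = w}"

lemma tr_one: "a \<in> A \<Longrightarrow> tr \<one> a = \<one>"
  using tr_mult[of \<one> \<one> a] tr_closed[of \<one> a] by (simp add: out_one)

lemma act_closed: "w \<in> lists A \<Longrightarrow> g \<in> carrier G \<Longrightarrow> act g w \<in> lists A"
  by (induction w arbitrary: g) (auto simp: out_closed tr_closed)

lemma act_one: "w \<in> lists A \<Longrightarrow> act \<one> w = w"
  by (induction w) (auto simp: out_one tr_one)

lemma act_mult:
  "w \<in> lists A \<Longrightarrow> g \<in> carrier G \<Longrightarrow> h \<in> carrier G \<Longrightarrow> act (g \<otimes> h) w = act g (act h w)"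
  by (induction w arbitrary: g h) (auto simp: out_mult tr_mult tr_closed out_closed)

lemma act_kernel_closed:
  assumes "g \<in> act_kernel" "a \<in> A"
  shows "out g a = a" "tr g a \<in> act_kernel"
proof -
  have g: "g \<in> carrier G" "\<And>w. w \<in> lists A \<Longrightarrow> act g w = w"
    using assms by (auto simp: act_kernel_def)
  have "act g (a # w) = a # w" if "w \<in> lists A" for w
    using g(2)[of "a # w"] assms(2) that by auto
  then show "out g a = a" "tr g a \<in> act_kernel"
    using tr_closed[OF g(1) assms(2)] by (auto simp: act_kernel_def)
qed

text \<open>The kernel is the largest set of group elements that fix every letter and whose transitions
  stay in the set. Together with \<open>act_kernel_closed\<close> this allows the kernel to be handled without
  mentioning words.\<close>

lemma act_kernel_coinduct:
  assumes "P \<subseteq> carrier G" "\<And>g a. g \<in> P \<Longrightarrow> a \<in> A \<Longrightarrow> out g a = a \<and> tr g a \<in> P"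
  shows "P \<subseteq> act_kernel"
proof -
  have "act g w = w" if "w \<in> lists A" "g \<in> P" for g w
    using that by (induction w arbitrary: g) (auto simp: assms(2))
  then show ?thesis using assms(1) by (auto simp: act_kernel_def)
qed

text \<open>The elements of \<open>T\<close> are the states of a Mealy automaton over \<open>A\<close>. It is invertible because
  \<open>out\<close> is a group action, and the injectivity hypotheses give the other two bijections because all
  sets are finite. As \<open>T\<close> generates \<open>G\<close>, the states generate the image of \<open>G\<close> in the
  permutations of words, so both groups are this image up to isomorphism.\<close>

theorem bireversible_quotient:
  assumes finA: "finite A" and finT: "finite T" and T: "T \<subseteq> carrier G"
    and gen: "generate G T = carrier G"
    and trT: "\<And>t a. t \<in> T \<Longrightarrow> a \<in> A \<Longrightarrow> tr t a \<in> T"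
    and rev: "\<And>t u a. \<lbrakk>t \<in> T; u \<in> T; a \<in> A; tr t a = tr u a\<rbrakk> \<Longrightarrow> t = u"
    and birev: "\<And>t u a b. \<lbrakk>t \<in> T; u \<in> T; a \<in> A; b \<in> A; out t a = out u b; tr t a = tr u b\<rbrakk>
      \<Longrightarrow> t = u \<and> a = b"
  shows "act_kernel \<lhd> G" and "bireversible_group (G Mod act_kernel)"
proof -
  \<comment> \<open>Letters and states are coded as numbers by \<open>e\<close> and \<open>c\<close>, with inverses \<open>d\<close> and \<open>b\<close>;
    \<open>p\<close> below is the action of \<open>G\<close> on coded words.\<close>
  obtain e :: "'b \<Rightarrow> nat" where e: "inj_on e A"
    using finite_imp_inj_to_nat_seg[OF finA] by metis
  obtain c :: "'a \<Rightarrow> nat" where c: "inj_on c T"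
    using finite_imp_inj_to_nat_seg[OF finT] by metis
  define d where "d = inv_into A e"
  define b where "b = inv_into T c"
  have d [simp]: "d (e a) = a" if "a \<in> A" for a using e that by (simp add: d_def)
  have b [simp]: "b (c t) = t" if "t \<in> T" for t using c that by (simp add: b_def)
  define M :: "(nat, nat) mealy" where
    "M = \<lparr>alphabet = e ` A, states = c ` T, out_fun = \<lambda>q x. e (out (b q) (d x)),
          trans_fun = \<lambda>q x. c (tr (b q) (d x))\<rparr>"
  have M_sel [simp]: "alphabet M = e ` A" "states M = c ` T"
    "out_fun M q x = e (out (b q) (d x))" "trans_fun M q x = c (tr (b q) (d x))" for q x
    by (simp_all add: M_def)
  have Tc: "t \<in> carrier G" if "t \<in> T" for t using T that by blast
  have out_inj: "a = a'" if "g \<in> carrier G" "a \<in> A" "a' \<in> A" "out g a = out g a'" for g a a'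
    using that by (metis inv_closed l_inv out_mult out_one)
  have autM: "mealy_automaton M"
    using finA finT by (auto simp: mealy_automaton_def out_closed Tc trT)
  have invM: "mealy_invertible M"
    unfolding mealy_invertible_def
  proof
    fix q assume "q \<in> states M"
    then obtain t where t: "t \<in> T" "q = c t" by auto
    have "inj_on (out_fun M q) (alphabet M)"
      by (rule inj_onI) (use t e in \<open>auto simp: inj_on_eq_iff out_closed Tc intro: out_inj[OF Tc]\<close>)
    moreover have "out_fun M q ` alphabet M \<subseteq> alphabet M"
      using t by (auto simp: out_closed Tc)
    ultimately show "bij_betw (out_fun M q) (alphabet M) (alphabet M)"
      using finA by (simp add: bij_betw_def endo_inj_surj del: M_sel(3))
  qed
  have "mealy_reversible M"
    unfolding mealy_reversible_def
  proof
    fix x assume "x \<in> alphabet M"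
    then obtain a where a: "a \<in> A" "x = e a" by auto
    have "inj_on (\<lambda>q. trans_fun M q x) (states M)"
      by (rule inj_onI) (use a rev c in \<open>auto simp: inj_on_eq_iff trT\<close>)
    moreover have "(\<lambda>q. trans_fun M q x) ` states M \<subseteq> states M"
      using a by (auto simp: trT)
    ultimately show "bij_betw (\<lambda>q. trans_fun M q x) (states M) (states M)"
      using finT by (simp add: bij_betw_def endo_inj_surj del: M_sel(4))
  qed
  moreover have "bij_betw (\<lambda>(q, a). (out_fun M q a, trans_fun M q a))
       (states M \<times> alphabet M) (alphabet M \<times> states M)" (is "bij_betw ?f ?X ?Y")
  proof -
    have inj: "inj_on ?f ?X"
    proof (rule inj_onI)
      fix x y assume x: "x \<in> ?X" and y: "y \<in> ?X" and eq: "?f x = ?f y"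
      obtain t a where t: "x = (c t, e a)" "t \<in> T" "a \<in> A" using x by auto
      obtain u a' where u: "y = (c u, e a')" "u \<in> T" "a' \<in> A" using y by auto
      have "e (out t a) = e (out u a')" "c (tr t a) = c (tr u a')"
        using eq t u by simp_all
      then have "out t a = out u a'" "tr t a = tr u a'"
        using t u e c by (simp_all add: inj_on_eq_iff trT out_closed Tc)
      then show "x = y" using birev t u by blast
    qed
    have sub: "?f ` ?X \<subseteq> ?Y" by (auto simp: trT out_closed Tc)
    have "card (?f ` ?X) = card ?Y"
      using card_image[OF inj] by (simp add: card_cartesian_product)
    then have "?f ` ?X = ?Y"
      using card_subset_eq[OF _ sub] finA finT by simp
    with inj show ?thesis by (simp add: bij_betw_def)
  qed
  ultimately have birevM: "mealy_bireversible M"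
    using autM invM by (simp add: mealy_bireversible_def)

  let ?W = "word_bijs M"
  interpret W: group ?W by (rule group_BijGroup)
  define p where "p g = (\<lambda>v \<in> lists (e ` A). map e (act g (map d v)))" for g
  have dA: "map d v \<in> lists A" if "v \<in> lists (e ` A)" for v
    using that by (induction v) auto
  have eA: "map e w \<in> lists (e ` A)" if "w \<in> lists A" for w
    using that by (induction w) auto
  have de [simp]: "map d (map e w) = w" if "w \<in> lists A" for w
    using that by (induction w) auto
  have ed [simp]: "map e (map d v) = v" if "v \<in> lists (e ` A)" for v
    using that by (induction v) auto
  have p_mem: "p g v \<in> lists (e ` A)" if "g \<in> carrier G" "v \<in> lists (e ` A)" for g v
    using that eA[OF act_closed[OF dA]] by (simp add: p_def)
  have p_mult: "p g (p h v) = p (g \<otimes> h) v"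
    if "g \<in> carrier G" "h \<in> carrier G" "v \<in> lists (e ` A)" for g h v
    using that p_mem[OF that(2,3)] de[OF act_closed[OF dA[OF that(3)] that(2)]]
      act_mult[OF dA[OF that(3)] that(1,2)]
    by (simp add: p_def del: map_map)
  have p_one: "p \<one> v = v" if "v \<in> lists (e ` A)" for v
    using that ed[OF that] by (simp add: p_def act_one[OF dA] del: map_map)
  have pB: "p g \<in> Bij (lists (e ` A))" if g: "g \<in> carrier G" for g
  proof -
    have "bij_betw (p g) (lists (e ` A)) (lists (e ` A))"
    proof (rule bij_betw_byWitness[where f' = "p (inv g)"])
      show "\<forall>v \<in> lists (e ` A). p (inv g) (p g v) = v" "\<forall>v \<in> lists (e ` A). p g (p (inv g) v) = v"
        using g by (simp_all add: p_mult p_one del: in_lists_conv_set)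
      show "p g ` lists (e ` A) \<subseteq> lists (e ` A)" "p (inv g) ` lists (e ` A) \<subseteq> lists (e ` A)"
        using p_mem[OF g] p_mem[OF inv_closed[OF g]] by blast+
    qed
    then show ?thesis by (simp add: Bij_def p_def)
  qed
  interpret p: group_hom G ?W p
  proof (intro group_hom.intro group_hom_axioms.intro homI group_axioms W.group_axioms)
    fix g h assume gh: "g \<in> carrier G" "h \<in> carrier G"
    show "p g \<in> carrier ?W" using pB gh by (simp add: BijGroup_def)
    have "p (g \<otimes> h) v = compose (lists (e ` A)) (p g) (p h) v" for v
    proof (cases "v \<in> lists (e ` A)")
      case True
      then show ?thesis using p_mult[OF gh True] by (simp only: compose_eq)
    qed (simp add: p_def compose_def)
    then show "p (g \<otimes> h) = p g \<otimes>\<^bsub>?W\<^esub> p h"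
      using pB gh by (auto simp: BijGroup_def)
  qed
  have ker: "kernel G ?W p = act_kernel"
  proof -
    have "p g = \<one>\<^bsub>?W\<^esub> \<longleftrightarrow> (\<forall>w \<in> lists A. act g w = w)" if g: "g \<in> carrier G" for g
    proof
      assume eq: "p g = \<one>\<^bsub>?W\<^esub>"
      show "\<forall>w \<in> lists A. act g w = w"
      proof
        fix w assume w: "w \<in> lists A"
        have "p g (map e w) = map e w"
          using eA[OF w] by (simp add: eq BijGroup_def)
        then have "map e (act g w) = map e w"
          using eA[OF w] de[OF w] by (simp add: p_def del: map_map)
        then have "map d (map e (act g w)) = map d (map e w)" by (simp only:)
        then show "act g w = w"
          by (simp only: de[OF w] de[OF act_closed[OF w g]])
      qed
    next
      assume "\<forall>w \<in> lists A. act g w = w"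
      then show "p g = \<one>\<^bsub>?W\<^esub>"
        using dA ed by (auto simp: p_def BijGroup_def fun_eq_iff restrict_def simp del: map_map)
    qed
    then show ?thesis by (auto simp: kernel_def act_kernel_def)
  qed
  have state: "state_bij M (c t) = p t" if t: "t \<in> T" for t
  proof -
    have "extend_output M (c t) v = map e (act t (map d v))" if "v \<in> lists (e ` A)" for v
      using that t by (induction v arbitrary: t) (auto simp: trT)
    then show ?thesis by (auto simp: state_bij_def p_def fun_eq_iff restrict_def)
  qed
  have "p ` carrier G = generate ?W (state_bij M ` states M)"
    using p.generate_img[OF T] gen state by (simp add: image_image)
  then have "G Mod act_kernel \<cong>
      ?W\<lparr>carrier := generate ?W (state_bij M ` states M)\<rparr>"
    using p.FactGroup_iso_image ker by simp
  moreover have "group (mealy_group M)"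
  proof -
    interpret f: group_hom "free_group (states M)" ?W "free_group_hom M"
      by (intro group_hom.intro group_hom_axioms.intro group_free_group group_BijGroup
          free_group_hom_hom[OF autM invM])
    show ?thesis
      unfolding mealy_group_def by (rule normal.factorgroup_is_group[OF f.normal_kernel])
  qed
  then have "?W\<lparr>carrier := generate ?W (state_bij M ` states M)\<rparr> \<cong> mealy_group M"
    using mealy_group_iso[OF autM invM] by (rule group.iso_sym)
  ultimately have "G Mod act_kernel \<cong> mealy_group M"
    by (rule iso_trans)
  then show "bireversible_group (G Mod act_kernel)"
    using birevM by (auto simp: bireversible_group_def)
  show "act_kernel \<lhd> G" using p.normal_kernel unfolding ker .
qed

end

section \<open>Local actions and the commensurator\<close>

lemma (in group) inv_cancel:
  assumes "x \<in> carrier G" "y \<in> carrier G"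
  shows "inv x \<otimes> (x \<otimes> y) = y" and "x \<otimes> (inv x \<otimes> y) = y"
  using assms by (simp_all add: m_assoc[symmetric])

lemma finite_image_iff_same_fibres:
  assumes "\<And>x y. x \<in> A \<Longrightarrow> y \<in> A \<Longrightarrow> f x = f y \<longleftrightarrow> g x = g y"
  shows "finite (f ` A) \<longleftrightarrow> finite (g ` A)"
proof -
  have *: "finite (q ` A)" if fin: "finite (p ` A)"
    and pq: "\<And>x y. x \<in> A \<Longrightarrow> y \<in> A \<Longrightarrow> p x = p y \<Longrightarrow> q x = q y" for p :: "_ \<Rightarrow> 'x" and q :: "_ \<Rightarrow> 'y"
  proof -
    have "q x = q (inv_into A p (p x))" if "x \<in> A" for x
      using that by (intro pq) (auto intro: inv_into_into f_inv_into_f[symmetric])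
    then have "q ` A \<subseteq> (\<lambda>z. q (inv_into A p z)) ` p ` A" by auto
    then show ?thesis using fin finite_surj by blast
  qed
  show ?thesis using *[of f g] *[of g f] assms by blast
qed

text \<open>A way to compute indices: if the cosets of \<open>f a\<close> are told apart exactly by \<open>g a\<close>, they can be
  counted by the values of \<open>g\<close>. The set \<open>f ` A\<close> is the bigger subgroup in the application.\<close>

lemma (in group) finite_index_iff:
  assumes M: "subgroup M G" and H: "f ` A \<subseteq> carrier G"
    and fib: "\<And>a b. a \<in> A \<Longrightarrow> b \<in> A \<Longrightarrow> f a \<otimes> inv (f b) \<in> M \<longleftrightarrow> g a = g b"
  shows "finite_index G (f ` A) M \<longleftrightarrow> finite (g ` A)"
proof -
  have Mc: "M \<subseteq> carrier G" using M by (rule subgroup.subset)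
  have "M #> f a = M #> f b \<longleftrightarrow> g a = g b" if "a \<in> A" "b \<in> A" for a b
  proof -
    have ab: "f a \<in> carrier G" "f b \<in> carrier G" using H that by auto
    have "M #> f a = M #> f b \<longleftrightarrow> M #> (f a \<otimes> inv (f b)) = M"
      using coset_mult_inv1[OF _ ab Mc] coset_mult_inv2[OF _ ab Mc] by blast
    also have "\<dots> \<longleftrightarrow> f a \<otimes> inv (f b) \<in> M"
      using coset_join1[OF _ _ M] coset_join2[OF _ M] ab by auto
    finally show ?thesis using fib[OF that] by simp
  qed
  then have "finite ((\<lambda>a. M #> f a) ` A) \<longleftrightarrow> finite (g ` A)"
    by (rule finite_image_iff_same_fibres)
  moreover have "rcosets\<^bsub>G\<lparr>carrier := f ` A\<rparr>\<^esub> M = (\<lambda>a. M #> f a) ` A"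
    by (auto simp: RCOSETS_def r_coset_def)
  ultimately show ?thesis by (simp add: finite_index_def)
qed

locale cayley = group G for G (structure) +
  fixes S :: "'a set"
  assumes finite_S: "finite S" and S_carrier: "S \<subseteq> carrier G"
    and generate_S: "generate G S = carrier G"
begin

abbreviation Aut where "Aut \<equiv> Aut_graph (cayley_graph G S)"

abbreviation Aut1 where "Aut1 \<equiv> stabilizer Aut (\<lambda>f. f) \<one>"

abbreviation C1 where "C1 \<equiv> comm_Aut G S \<inter> Aut1"

abbreviation L where "L \<equiv> left_mult G"

definition letters :: "'a set" where
  "letters = S \<union> set_inv\<^bsub>G\<^esub> S"

text \<open>The local action of \<open>k\<close> at \<open>g\<close> sends \<open>h\<close> to \<open>inv (k g) \<otimes> k (g \<otimes> h)\<close>: it is \<open>k\<close> seen from the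
  vertex \<open>g\<close>, with \<open>g\<close> and its image moved to the identity. Written as a product of
  automorphisms it is visibly an automorphism itself.\<close>

definition local_action :: "('a \<Rightarrow> 'a) \<Rightarrow> 'a \<Rightarrow> 'a \<Rightarrow> 'a" where
  "local_action k g = inv\<^bsub>Aut\<^esub> (L (k g)) \<otimes>\<^bsub>Aut\<^esub> k \<otimes>\<^bsub>Aut\<^esub> L g"

interpretation K: group Aut by (rule group_Aut_graph)

interpretation L: group_hom G Aut L
  by (intro group_hom.intro group_hom_axioms.intro group_axioms K.group_axioms
      left_mult_hom(1) S_carrier)

lemma finite_letters: "finite letters"
proof -
  have "set_inv\<^bsub>G\<^esub> S = (\<lambda>s. inv s) ` S" by (simp add: SET_INV_def UNION_singleton_eq_range)
  then show ?thesis using finite_S by (simp add: letters_def)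
qed

lemma letters_carrier: "letters \<subseteq> carrier G"
  using S_carrier by (auto simp: letters_def SET_INV_def)

lemma letters_inv: "t \<in> letters \<Longrightarrow> inv t \<in> letters"
  using S_carrier by (auto simp: letters_def SET_INV_def)

lemma generate_letters: "generate G letters = carrier G"
  using mono_generate[of S letters] generate_incl[OF letters_carrier] generate_S
  by (auto simp: letters_def)

lemma Aut_Bij: "k \<in> carrier Aut \<Longrightarrow> k \<in> Bij (carrier G)"
  by (auto simp: Aut_graph_def graph_auts_def cayley_graph_def)

lemma Aut_closed: "k \<in> carrier Aut \<Longrightarrow> x \<in> carrier G \<Longrightarrow> k x \<in> carrier G"
  using Bij_imp_funcset[OF Aut_Bij] by blast

lemma Aut_mult_apply:
  "k \<in> carrier Aut \<Longrightarrow> l \<in> carrier Aut \<Longrightarrow> x \<in> carrier G \<Longrightarrow> (k \<otimes>\<^bsub>Aut\<^esub> l) x = k (l x)"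
  using Aut_Bij[of k] Aut_Bij[of l]
  by (simp add: Aut_graph_def BijGroup_def cayley_graph_def compose_eq)

lemma Aut_one_apply: "x \<in> carrier G \<Longrightarrow> \<one>\<^bsub>Aut\<^esub> x = x"
  by (simp add: Aut_graph_def BijGroup_def cayley_graph_def)

lemma Aut_eqI:
  "k \<in> carrier Aut \<Longrightarrow> l \<in> carrier Aut \<Longrightarrow> (\<And>x. x \<in> carrier G \<Longrightarrow> k x = l x) \<Longrightarrow> k = l"
  by (rule extensionalityI[of _ "carrier G"]) (auto intro: Bij_imp_extensional Aut_Bij)

lemma Aut_inv_apply:
  assumes "k \<in> carrier Aut" "x \<in> carrier G"
  shows "(inv\<^bsub>Aut\<^esub> k) (k x) = x" and "k ((inv\<^bsub>Aut\<^esub> k) x) = x"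
  using Aut_mult_apply[of "inv\<^bsub>Aut\<^esub> k" k x] Aut_mult_apply[of k "inv\<^bsub>Aut\<^esub> k" x] assms
  by (simp_all add: Aut_one_apply)

lemma Aut_inj: "k \<in> carrier Aut \<Longrightarrow> x \<in> carrier G \<Longrightarrow> y \<in> carrier G \<Longrightarrow> k x = k y \<Longrightarrow> x = y"
  by (metis Aut_inv_apply(1))

lemma L_apply: "x \<in> carrier G \<Longrightarrow> L g x = g \<otimes> x"
  by (simp add: left_mult_def)

lemma Aut1_iff: "k \<in> Aut1 \<longleftrightarrow> k \<in> carrier Aut \<and> k \<one> = \<one>"
  by (auto simp: stabilizer_def)

lemma local_action_carrier:
  "k \<in> carrier Aut \<Longrightarrow> g \<in> carrier G \<Longrightarrow> local_action k g \<in> carrier Aut"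
  by (simp add: local_action_def Aut_closed)

lemma local_action_apply:
  assumes "k \<in> carrier Aut" "g \<in> carrier G" "h \<in> carrier G"
  shows "local_action k g h = inv (k g) \<otimes> k (g \<otimes> h)"
  using assms
  by (simp add: local_action_def L.hom_inv[symmetric] Aut_mult_apply Aut_closed L_apply
      del: L.hom_inv)

lemma apply_mult:
  assumes "k \<in> carrier Aut" "g \<in> carrier G" "h \<in> carrier G"
  shows "k (g \<otimes> h) = k g \<otimes> local_action k g h"
  using assms by (simp add: local_action_apply Aut_closed m_assoc inv_cancel)

lemma local_action_Aut1: "k \<in> carrier Aut \<Longrightarrow> g \<in> carrier G \<Longrightarrow> local_action k g \<in> Aut1"
  by (simp add: Aut1_iff local_action_carrier local_action_apply Aut_closed)

lemma local_action_local_action: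
  assumes "k \<in> carrier Aut" "g \<in> carrier G" "h \<in> carrier G"
  shows "local_action (local_action k g) h = local_action k (g \<otimes> h)"
  by (rule Aut_eqI)
    (use assms in \<open>simp_all add: local_action_carrier local_action_apply Aut_closed
      inv_mult_group m_assoc inv_cancel\<close>)

lemma local_action_one: "k \<in> Aut1 \<Longrightarrow> local_action k \<one> = k"
  by (rule Aut_eqI) (auto simp: Aut1_iff local_action_carrier local_action_apply Aut_closed)

lemma local_action_mult:
  assumes "k \<in> carrier Aut" "l \<in> carrier Aut" "g \<in> carrier G"
  shows "local_action (k \<otimes>\<^bsub>Aut\<^esub> l) g = local_action k (l g) \<otimes>\<^bsub>Aut\<^esub> local_action l g"
  by (rule Aut_eqI)
    (use assms in \<open>simp_all add: local_action_carrier local_action_apply Aut_closed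
      Aut_mult_apply m_assoc inv_cancel\<close>)

lemma local_action_unit:
  "g \<in> carrier G \<Longrightarrow> local_action \<one>\<^bsub>Aut\<^esub> g = \<one>\<^bsub>Aut\<^esub>"
  by (rule Aut_eqI)
    (simp_all add: local_action_carrier local_action_apply Aut_one_apply m_assoc inv_cancel)

lemma local_action_inv:
  assumes "k \<in> carrier Aut" "g \<in> carrier G"
  shows "local_action (inv\<^bsub>Aut\<^esub> k) g = inv\<^bsub>Aut\<^esub> (local_action k ((inv\<^bsub>Aut\<^esub> k) g))"
proof -
  have "local_action (inv\<^bsub>Aut\<^esub> k) g \<otimes>\<^bsub>Aut\<^esub> local_action k ((inv\<^bsub>Aut\<^esub> k) g) = \<one>\<^bsub>Aut\<^esub>"
    using local_action_mult[of "inv\<^bsub>Aut\<^esub> k" k "(inv\<^bsub>Aut\<^esub> k) g"] assms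
    by (simp add: local_action_unit Aut_closed Aut_inv_apply)
  then have "inv\<^bsub>Aut\<^esub> (local_action k ((inv\<^bsub>Aut\<^esub> k) g)) = local_action (inv\<^bsub>Aut\<^esub> k) g"
    by (rule K.inv_equality) (use assms in \<open>simp_all add: local_action_carrier Aut_closed\<close>)
  then show ?thesis by (rule sym)
qed

text \<open>As \<open>k\<close> fixes the identity, its local action at \<open>g\<close> takes the value \<open>inv (k g)\<close> at
  \<open>inv g\<close>. So the local action determines \<open>k g\<close>, and then all of \<open>k\<close>.\<close>

lemma local_action_inj:
  assumes k: "k \<in> Aut1" "l \<in> Aut1" and g: "g \<in> carrier G"
    and eq: "local_action k g = local_action l g"
  shows "k = l"
proof -
  have kl: "k \<in> carrier Aut" "l \<in> carrier Aut" "k \<one> = \<one>" "l \<one> = \<one>"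
    using k by (auto simp: Aut1_iff)
  have "inv (k g) = inv (l g)"
    using local_action_apply[of k g "inv g"] local_action_apply[of l g "inv g"] kl g eq
    by (simp add: Aut_closed)
  then have kg: "k g = l g"
    by (rule inj_onD[OF inv_inj _ Aut_closed[OF kl(1) g] Aut_closed[OF kl(2) g]])
  show ?thesis
  proof (rule Aut_eqI[OF kl(1,2)])
    fix x assume x: "x \<in> carrier G"
    then have "x = g \<otimes> (inv g \<otimes> x)" using g by (simp add: m_assoc inv_cancel)
    then show "k x = l x"
      using apply_mult[OF kl(1) g, of "inv g \<otimes> x"] apply_mult[OF kl(2) g, of "inv g \<otimes> x"] kg eq g x
      by simp
  qed
qed

text \<open>The letters are the neighbours of the identity.\<close>

lemma Aut1_letters:
  assumes "k \<in> Aut1" "t \<in> letters"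
  shows "k t \<in> letters"
proof -
  have t: "t \<in> carrier G" using assms letters_carrier by blast
  have edge: "(\<one>, x) \<in> parcs (cayley_graph G S) \<longleftrightarrow> x \<in> letters" if "x \<in> carrier G" for x
  proof -
    have "(\<one>, x) \<in> parcs (cayley_graph G S) \<longleftrightarrow> (\<exists>s \<in> letters. x = \<one> \<otimes> s)"
      by (auto simp: cayley_graph_def letters_def)
    also have "\<dots> \<longleftrightarrow> (\<exists>s \<in> letters. x = s)"
      using letters_carrier by (intro bex_cong) auto
    finally show ?thesis by simp
  qed
  have k: "k \<in> carrier Aut" "k \<one> = \<one>"
    using assms(1) by (simp_all add: Aut1_iff)
  then have "k \<in> graph_auts (cayley_graph G S)"
    by (simp add: Aut_graph_def)
  then have "(\<one>, t) \<in> parcs (cayley_graph G S) \<longleftrightarrow> (k \<one>, k t) \<in> parcs (cayley_graph G S)"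
    using t unfolding graph_auts_def by (simp add: cayley_graph_def)
  then show ?thesis using edge t k Aut_closed assms(2) by simp
qed

text \<open>If \<open>k\<close> conjugates the translation by \<open>a \<otimes> inv b\<close> to the translation by \<open>d\<close>, then evaluation
  at \<open>k b\<close> shows that \<open>d\<close> can only be \<open>k a \<otimes> inv (k b)\<close>; that this \<open>d\<close> works at all other vertices
  is the equality of the two local actions.\<close>

lemma conj_left_mult_iff:
  assumes k: "k \<in> carrier Aut" and ab: "a \<in> carrier G" "b \<in> carrier G"
  shows "k \<otimes>\<^bsub>Aut\<^esub> L (a \<otimes> inv b) \<otimes>\<^bsub>Aut\<^esub> inv\<^bsub>Aut\<^esub> k \<in> L ` carrier G \<longleftrightarrow>
    local_action k a = local_action k b"
proof
  assume "k \<otimes>\<^bsub>Aut\<^esub> L (a \<otimes> inv b) \<otimes>\<^bsub>Aut\<^esub> inv\<^bsub>Aut\<^esub> k \<in> L ` carrier G"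
  then obtain d where d: "d \<in> carrier G"
    "k \<otimes>\<^bsub>Aut\<^esub> L (a \<otimes> inv b) \<otimes>\<^bsub>Aut\<^esub> inv\<^bsub>Aut\<^esub> k = L d" by auto
  have *: "k (a \<otimes> x) = d \<otimes> k (b \<otimes> x)" if x: "x \<in> carrier G" for x
  proof -
    have "(k \<otimes>\<^bsub>Aut\<^esub> L (a \<otimes> inv b) \<otimes>\<^bsub>Aut\<^esub> inv\<^bsub>Aut\<^esub> k) (k (b \<otimes> x)) = k (a \<otimes> inv b \<otimes> (b \<otimes> x))"
      using k ab x by (simp add: Aut_mult_apply Aut_closed Aut_inv_apply L_apply del: L.hom_mult L.hom_inv)
    also have "a \<otimes> inv b \<otimes> (b \<otimes> x) = a \<otimes> x"
      using ab x by (simp add: m_assoc inv_cancel)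
    finally show ?thesis using d k ab x by (simp add: L_apply Aut_closed)
  qed
  have "k a = d \<otimes> k b" using *[of \<one>] ab by simp
  then have "inv (k a) \<otimes> k (a \<otimes> x) = inv (k b) \<otimes> k (b \<otimes> x)" if "x \<in> carrier G" for x
    using *[OF that] d(1) k ab that
    by (simp add: Aut_closed inv_mult_group m_assoc inv_cancel)
  then show "local_action k a = local_action k b"
    by (intro Aut_eqI) (use k ab in \<open>simp_all add: local_action_carrier local_action_apply\<close>)
next
  assume eq: "local_action k a = local_action k b"
  have "k \<otimes>\<^bsub>Aut\<^esub> L (a \<otimes> inv b) \<otimes>\<^bsub>Aut\<^esub> inv\<^bsub>Aut\<^esub> k = L (k a \<otimes> inv (k b))"
  proof (rule Aut_eqI)
    fix x assume x: "x \<in> carrier G"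
    define y where "y = inv b \<otimes> (inv\<^bsub>Aut\<^esub> k) x"
    have y: "y \<in> carrier G" "b \<otimes> y = (inv\<^bsub>Aut\<^esub> k) x"
      using k ab x by (simp_all add: y_def Aut_closed m_assoc inv_cancel)
    have "(k \<otimes>\<^bsub>Aut\<^esub> L (a \<otimes> inv b) \<otimes>\<^bsub>Aut\<^esub> inv\<^bsub>Aut\<^esub> k) x = k (a \<otimes> y)"
      using k ab x by (simp add: Aut_mult_apply Aut_closed L_apply y_def m_assoc del: L.hom_mult L.hom_inv)
    also have "\<dots> = k a \<otimes> (inv (k b) \<otimes> k (b \<otimes> y))"
      using apply_mult[OF k ab(1) y(1)] apply_mult[OF k ab(2) y(1)] eq k ab y(1)
      by (simp add: Aut_closed local_action_carrier m_assoc inv_cancel)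
    finally show "(k \<otimes>\<^bsub>Aut\<^esub> L (a \<otimes> inv b) \<otimes>\<^bsub>Aut\<^esub> inv\<^bsub>Aut\<^esub> k) x = L (k a \<otimes> inv (k b)) x"
      using k ab x by (simp add: y(2) Aut_inv_apply L_apply Aut_closed m_assoc del: L.hom_mult L.hom_inv)
  qed (use k ab in \<open>simp_all add: Aut_closed del: L.hom_mult L.hom_inv\<close>)
  then show "k \<otimes>\<^bsub>Aut\<^esub> L (a \<otimes> inv b) \<otimes>\<^bsub>Aut\<^esub> inv\<^bsub>Aut\<^esub> k \<in> L ` carrier G"
    using k ab by (simp add: Aut_closed del: L.hom_mult L.hom_inv)
qed

lemma finite_local_actions_inv:
  assumes k: "k \<in> carrier Aut" and fin: "finite (local_action k ` carrier G)"
  shows "finite (local_action (inv\<^bsub>Aut\<^esub> k) ` carrier G)"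
proof (rule finite_subset)
  show "local_action (inv\<^bsub>Aut\<^esub> k) ` carrier G \<subseteq> (\<lambda>l. inv\<^bsub>Aut\<^esub> l) ` local_action k ` carrier G"
    using k by (auto simp: local_action_inv Aut_closed)
qed (use fin in simp)

text \<open>The index of the intersection in the conjugate of \<open>G\<close> by \<open>k\<close> is the number of local actions
  of \<open>k\<close>, and its index in \<open>G\<close> is that of the inverse of \<open>k\<close>. The local actions of the inverse are the
  inverses of those of \<open>k\<close>, so both indices are finite together.\<close>

theorem comm_Aut_iff:
  "k \<in> comm_Aut G S \<longleftrightarrow> k \<in> carrier Aut \<and> finite (local_action k ` carrier G)"
proof (cases "k \<in> carrier Aut")
  case k: True
  define c where "c = (\<lambda>h. k \<otimes>\<^bsub>Aut\<^esub> h \<otimes>\<^bsub>Aut\<^esub> inv\<^bsub>Aut\<^esub> k)"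
  define H where "H = L ` carrier G"
  interpret c: group_hom Aut Aut c
    unfolding c_def by (intro group_hom.intro group_hom_axioms.intro K.group_axioms K.conj_hom k)
  have sub_H: "subgroup H Aut"
    unfolding H_def by (rule L.img_is_subgroup)
  have sub_c: "subgroup (c ` H) Aut"
    by (rule c.subgroup_img_is_subgroup[OF sub_H])
  have M: "subgroup (H \<inter> c ` H) Aut"
    by (rule K.subgroups_Inter_pair[OF sub_H sub_c])
  have cL: "c ` H = (\<lambda>g. c (L g)) ` carrier G" by (auto simp: H_def)
  have mem_cH: "h \<in> c ` H \<longleftrightarrow> inv\<^bsub>Aut\<^esub> k \<otimes>\<^bsub>Aut\<^esub> h \<otimes>\<^bsub>Aut\<^esub> inv\<^bsub>Aut\<^esub> (inv\<^bsub>Aut\<^esub> k) \<in> H"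
    (is "_ \<longleftrightarrow> ?d h \<in> H") if h: "h \<in> carrier Aut" for h
  proof -
    have cd: "c (?d h) = h" using h k by (simp add: c_def K.m_assoc K.inv_cancel)
    have dc: "?d (c x) = x" if "x \<in> H" for x
      using subgroup.mem_carrier[OF sub_H that] k by (simp add: c_def K.m_assoc K.inv_cancel)
    show ?thesis
    proof
      assume "h \<in> c ` H"
      then obtain x where x: "x \<in> H" "h = c x" by blast
      show "?d h \<in> H" unfolding x(2) dc[OF x(1)] by (rule x(1))
    next
      assume "?d h \<in> H"
      then have "c (?d h) \<in> c ` H" by (rule imageI)
      then show "h \<in> c ` H" unfolding cd .
    qed
  qed
  have diff: "L a \<otimes>\<^bsub>Aut\<^esub> inv\<^bsub>Aut\<^esub> (L b) = L (a \<otimes> inv b)"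
    if "a \<in> carrier G" "b \<in> carrier G" for a b
    using that by simp
  have "finite_index Aut (L ` carrier G) (H \<inter> c ` H) \<longleftrightarrow>
      finite (local_action (inv\<^bsub>Aut\<^esub> k) ` carrier G)"
  proof (rule K.finite_index_iff[OF M])
    fix a b assume ab: "a \<in> carrier G" "b \<in> carrier G"
    have LH: "L (a \<otimes> inv b) \<in> H"
      unfolding H_def using ab by (intro imageI m_closed inv_closed)
    then have "L (a \<otimes> inv b) \<in> H \<inter> c ` H \<longleftrightarrow> L (a \<otimes> inv b) \<in> c ` H" by blast
    also have "\<dots> \<longleftrightarrow> local_action (inv\<^bsub>Aut\<^esub> k) a = local_action (inv\<^bsub>Aut\<^esub> k) b"
      using conj_left_mult_iff[OF K.inv_closed[OF k] ab] mem_cH[of "L (a \<otimes> inv b)"] ab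
      by (simp only: H_def L.hom_closed m_closed inv_closed)
    finally show "L a \<otimes>\<^bsub>Aut\<^esub> inv\<^bsub>Aut\<^esub> (L b) \<in> H \<inter> c ` H \<longleftrightarrow>
        local_action (inv\<^bsub>Aut\<^esub> k) a = local_action (inv\<^bsub>Aut\<^esub> k) b"
      by (simp only: diff[OF ab])
  qed auto
  moreover have "finite_index Aut ((\<lambda>g. c (L g)) ` carrier G) (H \<inter> c ` H) \<longleftrightarrow>
      finite (local_action k ` carrier G)"
  proof (rule K.finite_index_iff[OF M])
    fix a b assume ab: "a \<in> carrier G" "b \<in> carrier G"
    have "c (L a) \<otimes>\<^bsub>Aut\<^esub> inv\<^bsub>Aut\<^esub> (c (L b)) = c (L a \<otimes>\<^bsub>Aut\<^esub> inv\<^bsub>Aut\<^esub> (L b))"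
      using ab by (simp add: c.hom_inv c.hom_mult del: L.hom_inv)
    also have "\<dots> = c (L (a \<otimes> inv b))" by (simp only: diff[OF ab])
    finally have eq: "c (L a) \<otimes>\<^bsub>Aut\<^esub> inv\<^bsub>Aut\<^esub> (c (L b)) = c (L (a \<otimes> inv b))" .
    have "c (L (a \<otimes> inv b)) \<in> H \<inter> c ` H \<longleftrightarrow> c (L (a \<otimes> inv b)) \<in> H"
      using ab unfolding H_def by (blast intro: m_closed inv_closed)
    also have "\<dots> \<longleftrightarrow> local_action k a = local_action k b"
      using conj_left_mult_iff[OF k ab] by (simp only: H_def c_def)
    finally show "c (L a) \<otimes>\<^bsub>Aut\<^esub> inv\<^bsub>Aut\<^esub> (c (L b)) \<in> H \<inter> c ` H \<longleftrightarrow>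
        local_action k a = local_action k b"
      by (simp only: eq)
  qed (auto simp: image_subset_iff)
  moreover have "k <#\<^bsub>Aut\<^esub> H #>\<^bsub>Aut\<^esub> (inv\<^bsub>Aut\<^esub> k) = c ` H"
    unfolding c_def by (rule conj_coset_eq)
  ultimately show ?thesis
    using k finite_local_actions_inv[OF k]
    by (auto simp: comm_Aut_def commensurator_def Let_def H_def[symmetric] cL)
qed (auto simp: comm_Aut_def commensurator_def)

text \<open>Finiteness of the set of local actions passes to products and inverses, so the
  commensurator and \<open>C1\<close> are closed under them by \<open>comm_Aut_iff\<close>.\<close>

lemma subgroup_C1: "subgroup C1 Aut"
proof (rule K.subgroupI)
  have "\<one>\<^bsub>Aut\<^esub> \<in> C1"
    by (simp add: comm_Aut_iff Aut1_iff Aut_one_apply local_action_unit image_constant_conv)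
  then show "C1 \<noteq> {}" by blast
  show "C1 \<subseteq> carrier Aut" by (auto simp: comm_Aut_iff)
  fix k assume k: "k \<in> C1"
  then have kA: "k \<in> carrier Aut" by (simp add: comm_Aut_iff)
  show "inv\<^bsub>Aut\<^esub> k \<in> C1"
    using k finite_local_actions_inv[OF kA] Aut_inv_apply(1)[OF kA one_closed]
    by (simp add: comm_Aut_iff Aut1_iff)
  fix l assume l: "l \<in> C1"
  then have lA: "l \<in> carrier Aut" by (simp add: comm_Aut_iff)
  have "local_action (k \<otimes>\<^bsub>Aut\<^esub> l) ` carrier G \<subseteq>
      (\<lambda>(p, q). p \<otimes>\<^bsub>Aut\<^esub> q) ` (local_action k ` carrier G \<times> local_action l ` carrier G)"
    using kA lA by (auto simp: local_action_mult Aut_closed)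
  then have "finite (local_action (k \<otimes>\<^bsub>Aut\<^esub> l) ` carrier G)"
    by (rule finite_subset) (use k l in \<open>simp add: comm_Aut_iff\<close>)
  then show "k \<otimes>\<^bsub>Aut\<^esub> l \<in> C1"
    using k l by (simp add: comm_Aut_iff Aut1_iff Aut_mult_apply)
qed

lemma C1_group_eq: "C1_group G S = Aut\<lparr>carrier := C1\<rparr>"
  by (simp add: C1_group_def Let_def)

lemma comm_Aut_inv: "k \<in> comm_Aut G S \<Longrightarrow> inv\<^bsub>Aut\<^esub> k \<in> comm_Aut G S"
  by (simp add: comm_Aut_iff finite_local_actions_inv)

lemma local_action_C1:
  assumes k: "k \<in> comm_Aut G S" and g: "g \<in> carrier G"
  shows "local_action k g \<in> C1"
proof -
  have kA: "k \<in> carrier Aut" and fin: "finite (local_action k ` carrier G)"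
    using k by (simp_all add: comm_Aut_iff)
  have "local_action (local_action k g) ` carrier G \<subseteq> local_action k ` carrier G"
    using kA g by (auto simp: local_action_local_action)
  then show ?thesis
    using kA g fin by (simp add: comm_Aut_iff local_action_Aut1 local_action_carrier finite_subset)
qed

section \<open>The dual automaton\<close>

definition local_closure :: "('a \<Rightarrow> 'a) set \<Rightarrow> ('a \<Rightarrow> 'a) set" where
  "local_closure F = (\<Union>k \<in> F. local_action k ` carrier G)"

lemma finite_local_closure: "finite F \<Longrightarrow> F \<subseteq> C1 \<Longrightarrow> finite (local_closure F)"
  by (auto simp: local_closure_def comm_Aut_iff)

lemma local_closure_C1: "F \<subseteq> C1 \<Longrightarrow> local_closure F \<subseteq> C1"
  unfolding local_closure_def using local_action_C1 by blast

lemma local_closure_closed: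
  assumes "F \<subseteq> C1" "k \<in> local_closure F" "g \<in> carrier G"
  shows "local_action k g \<in> local_closure F"
proof -
  obtain l h where l: "l \<in> F" "h \<in> carrier G" "k = local_action l h"
    using assms(2) by (auto simp: local_closure_def)
  then have "l \<in> carrier Aut" using assms(1) by (auto simp: comm_Aut_iff)
  then have "local_action k g = local_action l (h \<otimes> g)"
    using l assms(3) by (simp add: local_action_local_action)
  then show ?thesis using l assms(3) by (auto simp: local_closure_def)
qed

lemma local_closure_incl: "F \<subseteq> C1 \<Longrightarrow> F \<subseteq> local_closure F"
  unfolding local_closure_def using local_action_one one_closed by force

text \<open>Dually to automorphisms acting on words in the letters, the letters, and with them all of
  \<open>G\<close>, act on words of automorphisms: \<open>g\<close> replaces \<open>k\<close> by its local action at \<open>g\<close> and continues as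
  \<open>k g\<close>. This is a right action, and taking inverses turns it into a left action.\<close>

definition dual_out :: "'a \<Rightarrow> ('a \<Rightarrow> 'a) \<Rightarrow> 'a \<Rightarrow> 'a" where
  "dual_out g k = local_action k (inv g)"

definition dual_tr :: "'a \<Rightarrow> ('a \<Rightarrow> 'a) \<Rightarrow> 'a" where
  "dual_tr g k = inv (k (inv g))"

lemma dual_action:
  assumes F: "F \<subseteq> C1"
  shows "self_similar_action G (local_closure F) dual_out dual_tr"
proof
  fix g k assume g: "g \<in> carrier G" and k: "k \<in> local_closure F"
  then have k1: "k \<in> Aut1" and kA: "k \<in> carrier Aut"
    using local_closure_C1[OF F] by (auto simp: Aut1_iff)
  show "dual_out g k \<in> local_closure F"
    using local_closure_closed[OF F k] g by (simp add: dual_out_def)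
  show "dual_tr g k \<in> carrier G"
    using kA g by (simp add: dual_tr_def Aut_closed)
  fix h assume h: "h \<in> carrier G"
  show "dual_out (g \<otimes> h) k = dual_out g (dual_out h k)"
    using kA g h by (simp add: dual_out_def inv_mult_group local_action_local_action)
  show "dual_tr (g \<otimes> h) k = dual_tr g (dual_out h k) \<otimes> dual_tr h k"
    using kA g h
    by (simp add: dual_out_def dual_tr_def inv_mult_group apply_mult Aut_closed
        local_action_carrier)
next
  fix k assume "k \<in> local_closure F"
  then show "dual_out \<one> k = k"
    using local_closure_C1[OF F] by (auto simp: dual_out_def local_action_one)
qed

definition dual_kernel :: "('a \<Rightarrow> 'a) set \<Rightarrow> 'a set" where
  "dual_kernel F = self_similar_action.act_kernel G (local_closure F) dual_out dual_tr"

text \<open>All local actions fix the identity, so they permute the letters and the letters are a state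
  set. Reversibility is injectivity of an automorphism. For the third bijection, the local action
  \<open>m\<close> of \<open>k\<close> at \<open>inv t\<close> satisfies \<open>m t = inv (k (inv t))\<close>, so output and next state determine the
  state \<open>t\<close>, and then also \<open>k\<close>.\<close>

lemma dual_kernel_bireversible:
  assumes F: "F \<subseteq> C1" "finite F"
  shows "dual_kernel F \<lhd> G" and "bireversible_group (G Mod dual_kernel F)"
proof -
  interpret D: self_similar_action G "local_closure F" dual_out dual_tr
    by (rule dual_action[OF F(1)])
  have cl: "k \<in> Aut1" "k \<in> carrier Aut" if "k \<in> local_closure F" for k
    using local_closure_C1[OF F(1)] that by (auto simp: Aut1_iff)
  have tc: "t \<in> carrier G" if "t \<in> letters" for t using letters_carrier that by blast
  have inv_inj': "t = u" if "t \<in> carrier G" "u \<in> carrier G" "inv t = inv u" for t u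
    using inj_onD[OF inv_inj that(3,1,2)] .
  have trT: "dual_tr t k \<in> letters" if "t \<in> letters" "k \<in> local_closure F" for t k
    unfolding dual_tr_def
    by (rule letters_inv[OF Aut1_letters[OF cl(1)[OF that(2)] letters_inv[OF that(1)]]])
  have rev: "t = u"
    if "t \<in> letters" "u \<in> letters" "k \<in> local_closure F" "dual_tr t k = dual_tr u k" for t u k
  proof -
    have tu: "inv t \<in> carrier G" "inv u \<in> carrier G" using that tc by auto
    have k: "k \<in> carrier Aut" using that cl by blast
    have "k (inv t) = k (inv u)"
      by (rule inv_inj') (use that(4) Aut_closed[OF k tu(1)] Aut_closed[OF k tu(2)] in \<open>simp_all add: dual_tr_def\<close>)
    then have "inv t = inv u" using Aut_inj[OF k tu] by simp
    then show "t = u" using inv_inj' that tc by blast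
  qed
  have birev: "t = u \<and> k = l"
    if t: "t \<in> letters" "u \<in> letters" and k: "k \<in> local_closure F" "l \<in> local_closure F"
      and out: "dual_out t k = dual_out u l" and tr: "dual_tr t k = dual_tr u l" for t u k l
  proof -
    have tG: "t \<in> carrier G" "u \<in> carrier G" using t tc by auto
    have kA: "k \<in> carrier Aut" "l \<in> carrier Aut" "k \<one> = \<one>" "l \<one> = \<one>"
      using k cl by (auto simp: Aut1_iff)
    define m where "m = local_action k (inv t)"
    have m: "m \<in> carrier Aut" using kA tG by (simp add: m_def local_action_carrier)
    have "m t = dual_tr t k"
      using kA tG by (simp add: m_def dual_tr_def local_action_apply Aut_closed)
    moreover have "m u = dual_tr u l"
      using kA tG out by (simp add: m_def dual_out_def dual_tr_def local_action_apply Aut_closed)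
    ultimately have "t = u" using Aut_inj[OF m tG] tr by simp
    moreover from this have "k = l"
      using local_action_inj[of k l "inv t"] cl k tG out by (simp add: dual_out_def)
    ultimately show ?thesis by blast
  qed
  note quotient = D.bireversible_quotient[OF finite_local_closure[OF F(2,1)] finite_letters
      letters_carrier generate_letters]
  show "dual_kernel F \<lhd> G"
    unfolding dual_kernel_def by (rule quotient(1)) (fact trT rev birev)+
  show "bireversible_group (G Mod dual_kernel F)"
    unfolding dual_kernel_def by (rule quotient(2)) (fact trT rev birev)+
qed

text \<open>For the kernel elements the inverses in the definition of the action disappear, since the
  kernel is a subgroup.\<close>

lemma dual_kernel_closed:
  assumes F: "F \<subseteq> C1" "finite F" and n: "n \<in> dual_kernel F" and k: "k \<in> local_closure F"
  shows "local_action k n = k" and "k n \<in> dual_kernel F"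
proof -
  interpret D: self_similar_action G "local_closure F" dual_out dual_tr
    by (rule dual_action[OF F(1)])
  have sub: "subgroup (dual_kernel F) G"
    using dual_kernel_bireversible(1)[OF F] by (rule normal_imp_subgroup)
  have nG: "n \<in> carrier G" using subgroup.mem_carrier[OF sub n] .
  have kA: "k \<in> carrier Aut" using local_closure_C1[OF F(1)] k by (auto simp: Aut1_iff)
  have "inv n \<in> D.act_kernel"
    using subgroup.m_inv_closed[OF sub n] by (simp add: dual_kernel_def)
  from D.act_kernel_closed[OF this k]
  have *: "local_action k n = k" "inv (k n) \<in> dual_kernel F"
    using nG by (simp_all add: dual_out_def dual_tr_def dual_kernel_def)
  show "local_action k n = k" by (rule *(1))
  show "k n \<in> dual_kernel F"
    using subgroup.m_inv_closed[OF sub *(2)] inv_inv[OF Aut_closed[OF kA nG]] by simp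
qed

lemma dual_kernel_coinduct:
  assumes F: "F \<subseteq> C1" and P: "subgroup P G"
    and cl: "\<And>n k. n \<in> P \<Longrightarrow> k \<in> local_closure F \<Longrightarrow> local_action k n = k \<and> k n \<in> P"
  shows "P \<subseteq> dual_kernel F"
proof -
  interpret D: self_similar_action G "local_closure F" dual_out dual_tr
    by (rule dual_action[OF F])
  show ?thesis
    unfolding dual_kernel_def
    by (rule D.act_kernel_coinduct)
      (use cl subgroup.m_inv_closed[OF P] subgroup.subset[OF P] in \<open>auto simp: dual_out_def dual_tr_def\<close>)
qed

lemma dual_kernel_antimono:
  assumes "F \<subseteq> F'" "F' \<subseteq> C1" "finite F'"
  shows "dual_kernel F' \<subseteq> dual_kernel F"
proof (rule dual_kernel_coinduct)
  show "F \<subseteq> C1" using assms by blast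
  show "subgroup (dual_kernel F') G"
    using dual_kernel_bireversible(1)[OF assms(2,3)] by (rule normal_imp_subgroup)
  fix n k assume "n \<in> dual_kernel F'" "k \<in> local_closure F"
  moreover have "local_closure F \<subseteq> local_closure F'"
    using assms(1) by (auto simp: local_closure_def)
  ultimately show "local_action k n = k \<and> k n \<in> dual_kernel F'"
    using dual_kernel_closed[OF assms(2,3)] by blast
qed

section \<open>The quotients are infinite\<close>

primrec word_ball :: "nat \<Rightarrow> 'a set" where
  "word_ball 0 = {\<one>}"
| "word_ball (Suc n) = word_ball n \<union> (\<lambda>(g, t). g \<otimes> t) ` (word_ball n \<times> letters)"

lemma finite_word_ball: "finite (word_ball n)"
  by (induction n) (simp_all add: finite_letters)

lemma word_ball_carrier: "word_ball n \<subseteq> carrier G"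
  using letters_carrier by (induction n) auto

lemma word_ball_mono: "m \<le> n \<Longrightarrow> word_ball m \<subseteq> word_ball n"
  by (rule lift_Suc_mono_le[of word_ball]) auto

lemma word_ball_exhausts: "(\<Union>n. word_ball n) = carrier G"
proof
  show "(\<Union>n. word_ball n) \<subseteq> carrier G" using word_ball_carrier by blast
  have step: "u \<otimes> t \<in> (\<Union>n. word_ball n)" if u: "u \<in> (\<Union>n. word_ball n)" and t: "t \<in> letters" for u t
  proof -
    obtain n where "u \<in> word_ball n" using u by blast
    then have "u \<otimes> t \<in> word_ball (Suc n)" using t by auto
    then show ?thesis by blast
  qed
  have "u \<otimes> x \<in> (\<Union>n. word_ball n)" if "x \<in> generate G letters" "u \<in> (\<Union>n. word_ball n)" for u x
    using that
  proof (induction arbitrary: u)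
    case (eng h1 h2)
    have "u \<in> carrier G" using eng.prems word_ball_carrier by blast
    then have "u \<otimes> (h1 \<otimes> h2) = u \<otimes> h1 \<otimes> h2"
      using eng.hyps generate_letters by (simp add: m_assoc)
    then show ?case using eng.IH eng.prems by simp
  next
    case one
    moreover have "u \<in> carrier G" using one.prems word_ball_carrier by blast
    ultimately show ?case by simp
  qed (use step letters_inv in blast)+
  moreover have "\<one> \<in> (\<Union>n. word_ball n)" using word_ball.simps(1) by blast
  ultimately show "carrier G \<subseteq> (\<Union>n. word_ball n)"
    using generate_letters by (metis l_one subsetI)
qed

lemma finite_subset_word_ball:
  assumes "finite E" "E \<subseteq> carrier G"
  shows "\<exists>n. E \<subseteq> word_ball n"
  using assms
proof induction
  case (insert x E)
  obtain n where n: "E \<subseteq> word_ball n" using insert by auto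
  obtain m where "x \<in> word_ball m" using insert.prems word_ball_exhausts by blast
  then show ?case
    using n word_ball_mono[of n "max m n"] word_ball_mono[of m "max m n"] by (intro exI[of _ "max m n"]) auto
qed simp

lemma Aut1_word_ball: "k \<in> Aut1 \<Longrightarrow> x \<in> word_ball n \<Longrightarrow> k x \<in> word_ball n"
proof (induction n arbitrary: x)
  case (Suc n)
  show ?case
  proof (cases "x \<in> word_ball n")
    case False
    then obtain g t where gt: "g \<in> word_ball n" "t \<in> letters" "x = g \<otimes> t" using Suc.prems by auto
    then have c: "g \<in> carrier G" "t \<in> carrier G" using word_ball_carrier letters_carrier by auto
    have k: "k \<in> carrier Aut" using Suc.prems by (simp add: Aut1_iff)
    have "k x = k g \<otimes> local_action k g t" using apply_mult[OF k c] gt by simp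
    moreover have "k g \<in> word_ball n" using Suc gt by blast
    moreover have "local_action k g t \<in> letters"
      using Aut1_letters[OF local_action_Aut1[OF k c(1)] gt(2)] .
    ultimately show ?thesis by auto
  qed (use Suc in auto)
qed (simp add: Aut1_iff)

text \<open>These are the automorphisms fixing the identity that map \<open>N\<close> into itself and satisfy
  \<open>k (n \<otimes> x) = k n \<otimes> k x\<close> for \<open>n\<close> in \<open>N\<close>.\<close>

definition equivariant :: "'a set \<Rightarrow> ('a \<Rightarrow> 'a) set" where
  "equivariant N = {k \<in> Aut1. \<forall>n \<in> N. k n \<in> N \<and> local_action k n = k}"

lemma finite_index_representatives:
  assumes N: "subgroup N G" and fin: "finite (rcosets N)"
  obtains R where "finite R" "R \<subseteq> carrier G" "\<And>x. x \<in> carrier G \<Longrightarrow> \<exists>n \<in> N. \<exists>r \<in> R. x = n \<otimes> r"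
proof -
  define rep where "rep C = (SOME x. x \<in> C)" for C :: "'a set"
  have rep: "rep (N #> x) \<in> N #> x" if "x \<in> carrier G" for x
    unfolding rep_def using rcos_self[OF that N] by (rule someI)
  have Nc: "N \<subseteq> carrier G" using N by (rule subgroup.subset)
  show ?thesis
  proof
    show "finite (rep ` (rcosets N))" using fin by simp
    show "rep ` (rcosets N) \<subseteq> carrier G"
    proof -
      have "rep (N #> x) \<in> carrier G" if "x \<in> carrier G" for x
        using rep[OF that] r_coset_subset_G[OF Nc that] by blast
      then show ?thesis by (auto simp: RCOSETS_def)
    qed
    fix x assume x: "x \<in> carrier G"
    obtain n where n: "n \<in> N" "rep (N #> x) = n \<otimes> x"
      using rep[OF x] by (auto simp: r_coset_def)
    have "x = inv n \<otimes> rep (N #> x)" using n x Nc by (auto simp: inv_cancel)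
    moreover have "inv n \<in> N" using subgroup.m_inv_closed[OF N n(1)] .
    moreover have "rep (N #> x) \<in> rep ` (rcosets N)" using x by (auto simp: RCOSETS_def)
    ultimately show "\<exists>n \<in> N. \<exists>r \<in> rep ` (rcosets N). x = n \<otimes> r" by blast
  qed
qed

text \<open>An equivariant automorphism is a homomorphism on \<open>N\<close> and is determined by its values on
  \<open>N\<close> and on coset representatives. As in Schreier's lemma, its values on \<open>N\<close> follow from those on
  the representatives and on the elements \<open>r \<otimes> t \<otimes> inv r'\<close> of \<open>N\<close>, with representatives \<open>r\<close>, \<open>r'\<close>
  and a letter \<open>t\<close>. These elements lie in a finite ball, which is preserved by automorphisms fixing
  the identity; so there are only finitely many possibilities.\<close>

lemma finite_equivariant:
  assumes N: "subgroup N G" and fin: "finite (rcosets N)"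
  shows "finite (equivariant N)"
proof -
  obtain R where R: "finite R" "R \<subseteq> carrier G"
    and dec: "\<And>x. x \<in> carrier G \<Longrightarrow> \<exists>n \<in> N. \<exists>r \<in> R. x = n \<otimes> r"
    using finite_index_representatives[OF N fin] by metis
  define E where "E = R \<union> (\<lambda>(r, t, r'). r \<otimes> t \<otimes> inv r') ` (R \<times> letters \<times> R)"
  have "finite E" "E \<subseteq> carrier G"
    using R letters_carrier finite_letters by (auto simp: E_def)
  then obtain b where b: "E \<subseteq> word_ball b" using finite_subset_word_ball by blast
  have Nc: "n \<in> carrier G" if "n \<in> N" for n
    by (rule subgroup.mem_carrier[OF N that])
  have mult: "k (n \<otimes> x) = k n \<otimes> k x" if "k \<in> equivariant N" "n \<in> N" "x \<in> carrier G" for k n x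
    using that apply_mult[of k n x] Nc by (auto simp: equivariant_def Aut1_iff)
  have inj: "k = l" if kl: "k \<in> equivariant N" "l \<in> equivariant N"
    and agree: "\<And>x. x \<in> word_ball b \<Longrightarrow> k x = l x" for k l
  proof (rule Aut_eqI)
    show kA: "k \<in> carrier Aut" and lA: "l \<in> carrier Aut"
      using kl by (auto simp: equivariant_def Aut1_iff)
    \<comment> \<open>Schreier's rewriting along a word for \<open>x\<close>: if \<open>g = n \<otimes> r\<close>, then
      \<open>g \<otimes> t = n \<otimes> n' \<otimes> r'\<close> with \<open>n' = r \<otimes> t \<otimes> inv r'\<close> in \<open>E\<close>.\<close>
    have *: "\<exists>n \<in> N. \<exists>r \<in> R. x = n \<otimes> r \<and> k n = l n" if "x \<in> word_ball i" for x i
      using that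
    proof (induction i arbitrary: x)
      case 0
      obtain n r where nr: "n \<in> N" "r \<in> R" "\<one> = n \<otimes> r" using dec[OF one_closed] by blast
      have rG: "r \<in> carrier G" using nr R by blast
      have k1: "k \<one> = \<one>" "l \<one> = \<one>" using kl by (auto simp: equivariant_def Aut1_iff)
      have "k n \<otimes> k r = l n \<otimes> k r"
        using mult[OF kl(1) nr(1) rG] mult[OF kl(2) nr(1) rG] k1 nr(3) agree[of r] b nr(2)
        by (auto simp: E_def)
      moreover have "k n \<in> carrier G" "l n \<in> carrier G" "k r \<in> carrier G"
        using Aut_closed[OF kA] Aut_closed[OF lA] Nc[OF nr(1)] rG by blast+
      ultimately have "k n = l n" by simp
      then show ?case using nr 0 by auto
    next
      case (Suc i)
      show ?case
      proof (cases "x \<in> word_ball i")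
        case False
        then obtain g t where gt: "g \<in> word_ball i" "t \<in> letters" "x = g \<otimes> t" using Suc.prems by auto
        obtain n r where nr: "n \<in> N" "r \<in> R" "g = n \<otimes> r" "k n = l n" using Suc.IH[OF gt(1)] by blast
        have c: "n \<in> carrier G" "r \<in> carrier G" "t \<in> carrier G"
          using nr Nc R gt letters_carrier by auto
        then obtain n' r' where nr': "n' \<in> N" "r' \<in> R" "r \<otimes> t = n' \<otimes> r'"
          using dec[of "r \<otimes> t"] by auto
        have c': "n' \<in> carrier G" "r' \<in> carrier G" using nr' Nc R by auto
        have "n' = r \<otimes> t \<otimes> inv r'" using nr'(3) c' c by (simp add: m_assoc)
        then have "n' \<in> E" using nr nr' gt by (force simp: E_def)
        then have "k n' = l n'" using agree b by blast
        then have "k (n \<otimes> n') = l (n \<otimes> n')"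
          using mult[OF kl(1) nr(1) c'(1)] mult[OF kl(2) nr(1) c'(1)] nr(4) by simp
        moreover have "x = (n \<otimes> n') \<otimes> r'"
          using gt nr nr' c c' by (metis m_assoc)
        moreover have "n \<otimes> n' \<in> N" using subgroup.m_closed[OF N nr(1) nr'(1)] .
        ultimately show ?thesis using nr'(2) by blast
      qed (use Suc.IH in blast)
    qed
    fix x assume "x \<in> carrier G"
    then obtain i where "x \<in> word_ball i" using word_ball_exhausts by blast
    then obtain n r where nr: "n \<in> N" "r \<in> R" "x = n \<otimes> r" "k n = l n" using * by blast
    have rG: "r \<in> carrier G" using nr R by blast
    show "k x = l x"
      using mult[OF kl(1) nr(1) rG] mult[OF kl(2) nr(1) rG] nr agree[of r] b
      by (auto simp: E_def)
  qed
  have "inj_on (\<lambda>k. restrict k (word_ball b)) (equivariant N)"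
  proof (rule inj_onI)
    fix k l assume kl: "k \<in> equivariant N" "l \<in> equivariant N"
      and eq: "restrict k (word_ball b) = restrict l (word_ball b)"
    have "k x = l x" if "x \<in> word_ball b" for x using fun_cong[OF eq, of x] that by simp
    then show "k = l" using inj[OF kl] by blast
  qed
  moreover have "(\<lambda>k. restrict k (word_ball b)) ` equivariant N \<subseteq> word_ball b \<rightarrow>\<^sub>E word_ball b"
    using Aut1_word_ball by (auto simp: equivariant_def)
  ultimately show ?thesis
    by (rule inj_on_finite) (intro finite_PiE finite_word_ball)
qed

text \<open>The automorphisms in \<open>F\<close> are equivariant for the kernel, and so are their products. If the
  kernel had finite index, these would be finitely many. With the inverses of
  \<open>F0\<close> also in \<open>F\<close>, these products include the group generated by \<open>F0\<close>.\<close>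

lemma infinite_dual_quotient:
  assumes F: "F \<subseteq> C1" "finite F"
    and F0: "F0 \<subseteq> F" "\<And>k. k \<in> F0 \<Longrightarrow> inv\<^bsub>Aut\<^esub> k \<in> F"
    and inf: "infinite (generate Aut F0)"
  shows "infinite (carrier (G Mod dual_kernel F))"
proof
  assume "finite (carrier (G Mod dual_kernel F))"
  then have fin: "finite (rcosets (dual_kernel F))" by (simp add: FactGroup_def)
  have sub: "subgroup (dual_kernel F) G"
    using dual_kernel_bireversible(1)[OF F] by (rule normal_imp_subgroup)
  have Fe: "k \<in> equivariant (dual_kernel F)" if "k \<in> F" for k
    using that F(1) local_closure_incl[OF F(1)] dual_kernel_closed[OF F]
    unfolding equivariant_def by blast
  have "k \<in> equivariant (dual_kernel F)" if "k \<in> generate Aut F0" for k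
    using that
  proof induction
    case one
    then show ?case
      using subgroup.mem_carrier[OF sub]
      by (simp add: equivariant_def Aut1_iff Aut_one_apply local_action_unit)
  next
    case (eng k l)
    then have kl: "k \<in> carrier Aut" "l \<in> carrier Aut" by (auto simp: equivariant_def Aut1_iff)
    then show ?case
      using eng.IH subgroup.mem_carrier[OF sub]
      by (simp add: equivariant_def Aut1_iff Aut_mult_apply local_action_mult)
  qed (use Fe F0 in blast)+
  then have "finite (generate Aut F0)"
    using finite_equivariant[OF sub fin] by (meson finite_subset subsetI)
  then show False using inf by blast
qed

section \<open>The largest normalised subgroup\<close>

lemma conj_left_mult_eq_iff:
  assumes "k \<in> carrier Aut" "d \<in> carrier G" "e \<in> carrier G"
  shows "k \<otimes>\<^bsub>Aut\<^esub> L d \<otimes>\<^bsub>Aut\<^esub> inv\<^bsub>Aut\<^esub> k = L e \<longleftrightarrow>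
    (\<forall>x \<in> carrier G. k (d \<otimes> x) = e \<otimes> k x)"
proof -
  have "k \<otimes>\<^bsub>Aut\<^esub> L d \<otimes>\<^bsub>Aut\<^esub> inv\<^bsub>Aut\<^esub> k = L e \<longleftrightarrow> k \<otimes>\<^bsub>Aut\<^esub> L d = L e \<otimes>\<^bsub>Aut\<^esub> k"
    using assms by (metis K.inv_solve_right K.m_closed L.hom_closed)
  also have "\<dots> \<longleftrightarrow> (\<forall>x \<in> carrier G. (k \<otimes>\<^bsub>Aut\<^esub> L d) x = (L e \<otimes>\<^bsub>Aut\<^esub> k) x)"
    using assms by (auto intro: Aut_eqI)
  also have "\<dots> \<longleftrightarrow> (\<forall>x \<in> carrier G. k (d \<otimes> x) = e \<otimes> k x)"
    using assms by (intro ball_cong refl) (simp add: Aut_mult_apply L_apply Aut_closed)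
  finally show ?thesis .
qed

text \<open>If \<open>k\<close> conjugates the translation by \<open>d\<close> to that by \<open>e\<close>, then \<open>k (d \<otimes> x) = e \<otimes> k x\<close> for all
  \<open>x\<close>. As \<open>k\<close> fixes the identity, \<open>e = k d\<close>, and the equation says that \<open>k\<close> is its own local action
  at \<open>d\<close>.\<close>

lemma D_subgroup_closed:
  assumes d: "d \<in> D_subgroup G S" and k: "k \<in> C1"
  shows "local_action k d = k" and "k d \<in> D_subgroup G S"
proof -
  have N: "normalised_subgroup G S (D_subgroup G S)"
    by (rule largest_normalised_subgroup(1)[OF group_axioms S_carrier])
  then have sub: "subgroup (D_subgroup G S) G" by (simp add: normalised_subgroup_def)
  have kA: "k \<in> carrier Aut" "k \<one> = \<one>" using k by (auto simp: Aut1_iff)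
  have dG: "d \<in> carrier G" using subgroup.mem_carrier[OF sub d] .
  have LD: "L ` D_subgroup G S \<subseteq> carrier Aut"
    using subgroup.subset[OF sub] by auto
  have "k \<in> normalizer Aut (L ` D_subgroup G S)"
    using N k by (auto simp: normalised_subgroup_def)
  then have "k \<otimes>\<^bsub>Aut\<^esub> L d \<otimes>\<^bsub>Aut\<^esub> inv\<^bsub>Aut\<^esub> k \<in> L ` D_subgroup G S"
    using d unfolding normalizer_eq[OF LD] by blast
  then obtain e where e: "e \<in> D_subgroup G S"
    "k \<otimes>\<^bsub>Aut\<^esub> L d \<otimes>\<^bsub>Aut\<^esub> inv\<^bsub>Aut\<^esub> k = L e" by blast
  have eG: "e \<in> carrier G" using subgroup.mem_carrier[OF sub e(1)] .
  have *: "k (d \<otimes> x) = e \<otimes> k x" if "x \<in> carrier G" for x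
    using e(2) conj_left_mult_eq_iff[OF kA(1) dG eG] that by blast
  have kd: "k d = e" using *[of \<one>] dG eG kA by simp
  show "k d \<in> D_subgroup G S" using kd e by simp
  show "local_action k d = k"
    by (rule Aut_eqI)
      (use kA dG eG * kd in \<open>simp_all add: local_action_carrier local_action_apply inv_cancel Aut_closed\<close>)
qed

text \<open>By \<open>D_subgroup_closed\<close> and coinduction \<open>D\<^sub>G\<close> lies in every kernel. Conversely the intersection
  of the kernels is normal in \<open>G\<close>, and each \<open>m\<close> in \<open>C1\<close> maps it into itself and is equivariant for it,
  so conjugation by \<open>m\<close> maps translations by its elements to such translations. An arbitrary
  element of the commensurator is a translation times an element of \<open>C1\<close>.\<close>

theorem D_subgroup_eq:
  "D_subgroup G S = (\<Inter>F \<in> {F. finite F \<and> F \<subseteq> C1}. dual_kernel F)" (is "_ = ?D")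
proof
  have sub: "subgroup (D_subgroup G S) G"
    using largest_normalised_subgroup(1)[OF group_axioms S_carrier]
    by (simp add: normalised_subgroup_def)
  show "D_subgroup G S \<subseteq> ?D"
  proof (intro INT_greatest)
    fix F assume "F \<in> {F. finite F \<and> F \<subseteq> C1}"
    then have F: "F \<subseteq> C1" by blast
    show "D_subgroup G S \<subseteq> dual_kernel F"
    proof (rule dual_kernel_coinduct[OF F sub])
      fix n k assume n: "n \<in> D_subgroup G S" and "k \<in> local_closure F"
      then have k: "k \<in> C1" using local_closure_C1[OF F] by blast
      show "local_action k n = k \<and> k n \<in> D_subgroup G S"
        using D_subgroup_closed[OF n k] by blast
    qed
  qed
  have normal: "dual_kernel F \<lhd> G" if "finite F" "F \<subseteq> C1" for F
    using dual_kernel_bireversible(1) that by blast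
  have subD: "subgroup ?D G"
    by (rule subgroups_Inter) (auto intro: normal_imp_subgroup normal)
  have closed: "local_action k d = k" "k d \<in> ?D" if "d \<in> ?D" "k \<in> C1" for k d
  proof -
    \<comment> \<open>The kernel for \<open>F\<close> only controls automorphisms in the closure of \<open>F\<close>, so \<open>k\<close> is added to \<open>F\<close>.\<close>
    have *: "local_action k d = k \<and> k d \<in> dual_kernel F" if F: "finite F" "F \<subseteq> C1" for F
    proof -
      have F': "insert k F \<subseteq> C1" "finite (insert k F)" using F \<open>k \<in> C1\<close> by auto
      then have "d \<in> dual_kernel (insert k F)" using \<open>d \<in> ?D\<close> by blast
      moreover have "k \<in> local_closure (insert k F)" using local_closure_incl[OF F'(1)] by blast
      ultimately show ?thesis
        using dual_kernel_closed[OF F'] dual_kernel_antimono[of F "insert k F"] F' by blast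
    qed
    show "local_action k d = k" using *[of "{}"] by simp
    show "k d \<in> ?D" using * by blast
  qed
  have conj: "k \<otimes>\<^bsub>Aut\<^esub> L d \<otimes>\<^bsub>Aut\<^esub> inv\<^bsub>Aut\<^esub> k \<in> L ` ?D"
    if k: "k \<in> comm_Aut G S" and d: "d \<in> ?D" for k d
  proof -
    have kA: "k \<in> carrier Aut" using k by (simp add: comm_Aut_iff)
    \<comment> \<open>\<open>k\<close> is \<open>m\<close> followed by the translation by \<open>k \<one>\<close>.\<close>
    define m where "m = local_action k \<one>"
    define e where "e = k \<one> \<otimes> m d \<otimes> inv (k \<one>)"
    have m: "m \<in> C1" using local_action_C1[OF k] by (simp add: m_def)
    have mA: "m \<in> carrier Aut" using m by (simp add: Aut1_iff)
    have k1: "k \<one> \<in> carrier G" using kA by (simp add: Aut_closed)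
    have dG: "d \<in> carrier G" using subgroup.mem_carrier[OF subD d] .
    have md: "m d \<in> ?D" "local_action m d = m" using closed[OF d m] by blast+
    have mdG: "m d \<in> carrier G" using subgroup.mem_carrier[OF subD md(1)] .
    have "e \<in> dual_kernel F" if "finite F" "F \<subseteq> C1" for F
      unfolding e_def using md(1) that k1 by (intro normal.inv_op_closed2[OF normal]) auto
    then have e: "e \<in> ?D" by blast
    have "k (d \<otimes> x) = e \<otimes> k x" if x: "x \<in> carrier G" for x
    proof -
      have km: "k y = k \<one> \<otimes> m y" if "y \<in> carrier G" for y
        using apply_mult[OF kA one_closed that] that by (simp add: m_def)
      have "k (d \<otimes> x) = k \<one> \<otimes> (m d \<otimes> m x)"
        using km[of "d \<otimes> x"] apply_mult[OF mA dG x] md(2) dG x by simp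
      also have "\<dots> = e \<otimes> k x"
        using km[OF x] k1 mdG Aut_closed[OF mA x] by (simp add: e_def m_assoc inv_cancel)
      finally show ?thesis .
    qed
    then have "k \<otimes>\<^bsub>Aut\<^esub> L d \<otimes>\<^bsub>Aut\<^esub> inv\<^bsub>Aut\<^esub> k = L e"
      using conj_left_mult_eq_iff[OF kA dG subgroup.mem_carrier[OF subD e]] by blast
    then show ?thesis using e by blast
  qed
  have LD: "L ` ?D \<subseteq> carrier Aut" using subgroup.subset[OF subD] by auto
  have "normalised_subgroup G S ?D"
    unfolding normalised_subgroup_def normalizer_eq[OF LD]
  proof (intro conjI subsetI CollectI subD equalityI)
    fix k assume k: "k \<in> comm_Aut G S"
    then show kA: "k \<in> carrier Aut" by (simp add: comm_Aut_iff)
    let ?c = "\<lambda>h. k \<otimes>\<^bsub>Aut\<^esub> h \<otimes>\<^bsub>Aut\<^esub> inv\<^bsub>Aut\<^esub> k"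
    show "h \<in> L ` ?D" if "h \<in> ?c ` L ` ?D" for h
      using that conj[OF k] by blast
    fix h assume h: "h \<in> L ` ?D"
    let ?h' = "inv\<^bsub>Aut\<^esub> k \<otimes>\<^bsub>Aut\<^esub> h \<otimes>\<^bsub>Aut\<^esub> inv\<^bsub>Aut\<^esub> (inv\<^bsub>Aut\<^esub> k)"
    have "?h' \<in> L ` ?D" using conj[OF comm_Aut_inv[OF k]] h by blast
    moreover have "h = ?c ?h'"
      using h LD kA by (simp add: K.m_assoc K.inv_cancel subsetD)
    ultimately show "h \<in> ?c ` L ` ?D" by blast
  qed
  then show "?D \<subseteq> D_subgroup G S"
    by (rule largest_normalised_subgroup(2)[OF group_axioms S_carrier])
qed

text \<open>Adding elements to \<open>F\<close> shrinks the kernel and keeps its index infinite. For each \<open>g\<close> outside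
  \<open>D\<^sub>G\<close> some finite set \<open>W g\<close> has a kernel that avoids \<open>g\<close>; starting from a set that generates an
  infinite group, the sets \<open>W g\<close> for \<open>g\<close> in larger and larger balls are added.\<close>

theorem dual_kernel_sequence:
  assumes "\<not> locally_finite (C1_group G S)"
  obtains N where "\<And>i. N i \<lhd> G" "\<And>i. N (Suc i) \<subseteq> N i" "(\<Inter>i. N i) = D_subgroup G S"
    "\<And>i. infinite (carrier (G Mod N i))" "\<And>i. bireversible_group (G Mod N i)"
proof -
  obtain F0 where F0: "F0 \<subseteq> C1" "finite F0" "infinite (generate (C1_group G S) F0)"
    using assms by (auto simp: locally_finite_def C1_group_eq)
  then have inf: "infinite (generate Aut F0)"
    using K.generate_consistent[OF F0(1) subgroup_C1] by (simp add: C1_group_eq)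
  define F1 where "F1 = F0 \<union> (\<lambda>k. inv\<^bsub>Aut\<^esub> k) ` F0"
  have F1: "finite F1" "F1 \<subseteq> C1"
    using F0 subgroup.m_inv_closed[OF subgroup_C1] by (auto simp: F1_def simp del: Int_iff)
  have "\<exists>F. finite F \<and> F \<subseteq> C1 \<and> (g \<in> dual_kernel F \<longrightarrow> g \<in> D_subgroup G S)" for g
    by (cases "g \<in> D_subgroup G S") (auto simp: D_subgroup_eq simp del: Int_iff)
  then obtain W where W: "\<And>g. finite (W g)" "\<And>g. W g \<subseteq> C1"
    "\<And>g. g \<in> dual_kernel (W g) \<Longrightarrow> g \<in> D_subgroup G S" by metis
  define F where "F i = F1 \<union> (\<Union>g \<in> word_ball i. W g)" for i
  have F: "F i \<subseteq> C1" "finite (F i)" for i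
    using F1 W finite_word_ball by (auto simp: F_def simp del: Int_iff)
  show ?thesis
  proof (rule that[of "\<lambda>i. dual_kernel (F i)"])
    fix i
    show "dual_kernel (F i) \<lhd> G" "bireversible_group (G Mod dual_kernel (F i))"
      using dual_kernel_bireversible[OF F] by blast+
    show "infinite (carrier (G Mod dual_kernel (F i)))"
      by (rule infinite_dual_quotient[OF F _ _ inf]) (auto simp: F_def F1_def)
    show "dual_kernel (F (Suc i)) \<subseteq> dual_kernel (F i)"
      using word_ball_mono[of i "Suc i"] by (intro dual_kernel_antimono F) (force simp: F_def)
  next
    show "(\<Inter>i. dual_kernel (F i)) = D_subgroup G S"
    proof
      show "D_subgroup G S \<subseteq> (\<Inter>i. dual_kernel (F i))"
        using F by (auto simp: D_subgroup_eq simp del: Int_iff)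
      show "(\<Inter>i. dual_kernel (F i)) \<subseteq> D_subgroup G S"
      proof
        fix g assume g: "g \<in> (\<Inter>i. dual_kernel (F i))"
        then have "g \<in> dual_kernel (F 0)" by blast
        then have "g \<in> carrier G"
          by (rule subgroup.mem_carrier[OF normal_imp_subgroup[OF dual_kernel_bireversible(1)[OF F]]])
        then obtain i where "g \<in> word_ball i" using word_ball_exhausts by blast
        then have "W g \<subseteq> F i" by (auto simp: F_def)
        then have "g \<in> dual_kernel (W g)" using dual_kernel_antimono[OF _ F] g by blast
        then show "g \<in> D_subgroup G S" by (rule W(3))
      qed
    qed
  qed
qed

end

theorem theorem3p6:
  fixes G :: "('a, 'm) monoid_scheme" and S :: "'a set"
  assumes "group G"
    and "finite S" and "S \<subseteq> carrier G" and "generate G S = carrier G"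
    and "\<one>\<^bsub>G\<^esub> \<notin> S"
    and "\<not> locally_finite (C1_group G S)"
  shows "(\<exists>N :: nat \<Rightarrow> 'a set.
            (\<forall>i. N (Suc i) \<lhd> G\<lparr>carrier := N i\<rparr>) \<and>
            (\<forall>i. N i \<lhd> G) \<and>
            (\<forall>i. infinite (carrier (G Mod N i)) \<and> bireversible_group (G Mod N i)) \<and>
            (\<Inter>i. N i) = D_subgroup G S)
         \<and> residually_infinite_bireversible_mod G (D_subgroup G S)"
proof -
  interpret cayley G S
    using assms by (intro cayley.intro cayley_axioms.intro)
  obtain N where N: "\<And>i. N i \<lhd> G" "\<And>i. N (Suc i) \<subseteq> N i" "(\<Inter>i. N i) = D_subgroup G S"
    "\<And>i. infinite (carrier (G Mod N i))" "\<And>i. bireversible_group (G Mod N i)"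
    using dual_kernel_sequence[OF assms(6)] by blast
  have "N (Suc i) \<lhd> G\<lparr>carrier := N i\<rparr>" for i
    by (rule normal_restrict_supergroup[OF normal_imp_subgroup[OF N(1)] N(1,2)])
  moreover have "residually_infinite_bireversible_mod G (D_subgroup G S)"
    unfolding residually_infinite_bireversible_mod_def
  proof
    fix g assume "g \<in> carrier G - D_subgroup G S"
    then obtain i where "g \<notin> N i" using N(3) by blast
    moreover have "D_subgroup G S \<subseteq> N i" using N(3) by blast
    ultimately show "\<exists>N. N \<lhd> G \<and> D_subgroup G S \<subseteq> N \<and> g \<notin> N \<and>
        infinite (carrier (G Mod N)) \<and> bireversible_group (G Mod N)"
      using N by blast
  qed
  ultimately show ?thesis using N by blast
qed

end
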